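(* Let $\Bbbk$ be an algebraically closed field of characteristic zero and let $V$ be a finite semisimple Novikov conformal algebra over $\Bbbk$. Then $V$ is isomorphic to a (finite) direct sum of simple ones, $$V=V_1\oplus\dots\oplus V_k,$$ where for each $i=1,\dots,k$ either $V_i\cong\mathrm{Cur}_1$ or $V_i\cong\mathcal V_{\alpha_i}$ for some $\alpha_i\in\Bbbk$.
   Context: Let $H=\Bbbk[\partial]$. A conformal algebra is an $H$-module $V$ with a $\Bbbk$-bilinear operation ($\lambda$-product) $V\times V\to V[\lambda]$, $(a,b)\mapsto a\circ_{(\lambda)}b$, which is sesqui-linear: $(\partial a)\circ_{(\lambda)}b=-\lambda(a\circ_{(\lambda)}b)$, $a\circ_{(\lambda)}(\partial b)=(\partial+\lambda)(a\circ_{(\lambda)}b)$. It is finite if it is finitely generated as an $H$-module. If $a\circ_{(\lambda)}b=\sum_n\lambda^n c_n$, put $\{a\circ_{(\lambda)}b\}=a\circ_{(-\partial-\lambda)}b:=\sum_n(-\partial-\lambda)^nc_n$. A Novikov conformal algebra is a conformal algebra such that for all $a,b,c\in V$ (products extended coefficientwise to polynomials) $$(a\circ_{(\lambda)}b)\circ_{(\lambda+\mu)}c-a\circ_{(\lambda)}(b\circ_{(\mu)}c)=(b\circ_{(\mu)}a)\circ_{(\lambda+\mu)}c-b\circ_{(\mu)}(a\circ_{(\lambda)}c),$$ $$(a\circ_{(\lambda)}b)\circ_{(\mu)}c=\{(a\circ_{(\lambda)}c)\circ_{(\mu-\lambda)}b\}.$$ An ideal of $V$ is an $H$-submodule $I$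 with $I\circ_{(\lambda)}V\subseteq I[\lambda]$ and $V\circ_{(\lambda)}I\subseteq I[\lambda]$. For an ideal $I$ put $I^{(1)}=I$ and let $I^{(n+1)}=I^{(n)}I^{(n)}$ be the linear span of all coefficients of all $a\circ_{(\lambda)}b$, $a,b\in I^{(n)}$. $I$ is solvable if $I^{(n)}=0$ for some $n\ge1$; $V$ is semisimple if it has no nonzero solvable ideals. $V$ is simple if $V\circ_{(\lambda)}V\ne0$ and $V$ has no nonzero proper ideals. The direct sum is a direct sum of conformal algebras (each summand is an ideal; products of different summands vanish); the zero algebra is regarded as the empty direct sum. $\mathrm{Cur}_1=\mathrm{Cur}\,\Bbbk$ is the free $H$-module $Hv$ of rank one with $v\circ_{(\lambda)}v=v$. For $\alpha\in\Bbbk$, $\mathcal V_\alpha$ is the free $H$-module $Hv$ of rank one with $v\circ_{(\lambda)}v=(\partial+\lambda+\alpha)v$ (extended by sesqui-linearity). *)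

theory Defs
  imports
    "HOL-Computational_Algebra.Polynomial"
    "HOL-Library.FuncSet"
begin

text \<open>
  \<open>H = k[\<partial>]\<close> is the type \<open>'k poly\<close>, and \<open>\<partial>\<close> is \<open>[:0, 1:]\<close>.
  For an \<open>H\<close>-module on a type \<open>'v\<close>, the group \<open>V[\<lambda>]\<close> is the type \<open>'v poly\<close>.  In
  \<open>V[\<lambda>, \<mu>]\<close>, the type \<open>'v poly poly\<close>, the inner indeterminate is \<open>\<lambda>\<close> and the outer one is \<open>\<mu>\<close>.
\<close>

text \<open>
  \<open>subst_poly T e p\<close> is the sum of \<open>T\<^sup>n (e c\<^sub>n)\<close>, where \<open>c\<^sub>n\<close> are the coefficients of \<open>p\<close>: the map \<open>e\<close> is
  applied to the coefficients and the operator \<open>T\<close> is substituted for the indeterminate.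
\<close>

definition subst_poly ::
  "('m::comm_monoid_add \<Rightarrow> 'm) \<Rightarrow> ('v::zero \<Rightarrow> 'm) \<Rightarrow> 'v poly \<Rightarrow> 'm" where
  "subst_poly T e p = (\<Sum>n\<le>degree p. (T ^^ n) (e (coeff p n)))"

definition mult_lam :: "'v::ab_group_add poly poly \<Rightarrow> 'v poly poly" where
  "mult_lam = map_poly (pCons 0)"

definition mult_mu :: "'v::ab_group_add poly poly \<Rightarrow> 'v poly poly" where
  "mult_mu = pCons 0"

locale conformal_algebra = module scale
  for scale :: "'k::field poly \<Rightarrow> 'v::ab_group_add \<Rightarrow> 'v" +
  fixes lprod :: "'v \<Rightarrow> 'v \<Rightarrow> 'v poly"
  assumes lprod_add_left: "lprod (a + b) c = lprod a c + lprod b c"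
    and lprod_add_right: "lprod a (b + c) = lprod a b + lprod a c"
    and lprod_scalar_left: "lprod (scale [:r:] a) b = map_poly (scale [:r:]) (lprod a b)"
    and lprod_scalar_right: "lprod a (scale [:r:] b) = map_poly (scale [:r:]) (lprod a b)"
    and lprod_del_left: "lprod (scale [:0, 1:] a) b = - pCons 0 (lprod a b)"
    and lprod_del_right:
      "lprod a (scale [:0, 1:] b) = map_poly (scale [:0, 1:]) (lprod a b) + pCons 0 (lprod a b)"
begin

definition finite_conformal :: bool where
  "finite_conformal \<longleftrightarrow> (\<exists>B. finite B \<and> span B = UNIV)"

definition mult_del :: "'v poly poly \<Rightarrow> 'v poly poly" where
  "mult_del = map_poly (map_poly (scale [:0, 1:]))"

text \<open>
  For an operator \<open>T\<close> on \<open>V[\<lambda>, \<mu>]\<close>, \<open>lprod_at T a b\<close> is \<open>a \<circ>\<^bsub>(T)\<^esub> b\<close>, and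
  \<open>curly_at T a b\<close> is \<open>{a \<circ>\<^bsub>(T)\<^esub> b} = a \<circ>\<^bsub>(-\<partial>-T)\<^esub> b\<close>.
\<close>

definition lprod_at :: "('v poly poly \<Rightarrow> 'v poly poly) \<Rightarrow> 'v \<Rightarrow> 'v \<Rightarrow> 'v poly poly" where
  "lprod_at T a b = subst_poly T (\<lambda>c. [:[:c:]:]) (lprod a b)"

definition curly_at :: "('v poly poly \<Rightarrow> 'v poly poly) \<Rightarrow> 'v \<Rightarrow> 'v \<Rightarrow> 'v poly poly" where
  "curly_at T = lprod_at (\<lambda>p. - mult_del p - T p)"

definition novikov :: bool where
  "novikov \<longleftrightarrow>
    (\<forall>a b c.
      subst_poly mult_lam (\<lambda>x. lprod_at (\<lambda>p. mult_lam p + mult_mu p) x c) (lprod a b)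
      - subst_poly mult_mu (\<lambda>x. lprod_at mult_lam a x) (lprod b c)
      = subst_poly mult_mu (\<lambda>x. lprod_at (\<lambda>p. mult_lam p + mult_mu p) x c) (lprod b a)
      - subst_poly mult_lam (\<lambda>x. lprod_at mult_mu b x) (lprod a c)) \<and>
    (\<forall>a b c.
      subst_poly mult_lam (\<lambda>x. lprod_at mult_mu x c) (lprod a b)
      = subst_poly mult_lam (\<lambda>x. curly_at (\<lambda>p. mult_mu p - mult_lam p) x b) (lprod a c))"

text \<open>
  Subalgebras are given by their carrier sets; ideals and simplicity are relative to such a
  carrier \<open>S\<close>, the algebra itself being \<open>S = UNIV\<close>.
\<close>

definition subalgebra :: "'v set \<Rightarrow> bool" where
  "subalgebra S \<longleftrightarrow> subspace S \<and> (\<forall>a\<in>S. \<forall>b\<in>S. \<forall>n. coeff (lprod a b) n \<in> S)"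

definition ideal_of :: "'v set \<Rightarrow> 'v set \<Rightarrow> bool" where
  "ideal_of S I \<longleftrightarrow> I \<subseteq> S \<and> subspace I \<and>
    (\<forall>a\<in>I. \<forall>b\<in>S. \<forall>n. coeff (lprod a b) n \<in> I \<and> coeff (lprod b a) n \<in> I)"

definition simple :: "'v set \<Rightarrow> bool" where
  "simple S \<longleftrightarrow> subalgebra S \<and> (\<exists>a\<in>S. \<exists>b\<in>S. lprod a b \<noteq> 0) \<and>
    (\<forall>I. ideal_of S I \<longrightarrow> I = {0} \<or> I = S)"

text \<open>
  The linear span is over the field of scalars, not over \<open>H\<close>.  Indices are shifted by one:
  \<open>derived I n\<close> is \<open>I\<^bsup>(n+1)\<^esup>\<close>.
\<close>

primrec derived :: "'v set \<Rightarrow> nat \<Rightarrow> 'v set" where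
  "derived I 0 = I"
| "derived I (Suc n) = module.span (\<lambda>r. scale [:r:])
     {coeff (lprod a b) m |a b m. a \<in> derived I n \<and> b \<in> derived I n}"

definition solvable :: "'v set \<Rightarrow> bool" where
  "solvable I \<longleftrightarrow> (\<exists>n. derived I n = {0})"

definition semisimple :: bool where
  "semisimple \<longleftrightarrow> (\<forall>I. ideal_of UNIV I \<and> solvable I \<longrightarrow> I = {0})"

definition direct_sum_of_ideals :: "nat \<Rightarrow> (nat \<Rightarrow> 'v set) \<Rightarrow> bool" where
  "direct_sum_of_ideals k W \<longleftrightarrow>
    (\<forall>i<k. ideal_of UNIV (W i)) \<and>
    (\<forall>i<k. \<forall>j<k. i \<noteq> j \<longrightarrow> (\<forall>a\<in>W i. \<forall>b\<in>W j. lprod a b = 0)) \<and>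
    (\<forall>v. \<exists>!w. w \<in> (\<Pi>\<^sub>E i\<in>{..<k}. W i) \<and> v = (\<Sum>i<k. w i))"

end

text \<open>
  An isomorphism from the conformal algebra \<open>(s, p)\<close> onto the subalgebra with carrier \<open>W\<close>
  of \<open>(s', p')\<close>.
\<close>

definition isomorphic_onto ::
  "('k::field poly \<Rightarrow> 'w::ab_group_add \<Rightarrow> 'w) \<Rightarrow> ('w \<Rightarrow> 'w \<Rightarrow> 'w poly) \<Rightarrow>
   ('k poly \<Rightarrow> 'v::ab_group_add \<Rightarrow> 'v) \<Rightarrow> ('v \<Rightarrow> 'v \<Rightarrow> 'v poly) \<Rightarrow> 'v set \<Rightarrow> bool" where
  "isomorphic_onto s p s' p' W \<longleftrightarrow>
    (\<exists>\<phi>. module_hom s s' \<phi> \<and> bij_betw \<phi> UNIV W \<and>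
         (\<forall>a b. p' (\<phi> a) (\<phi> b) = map_poly \<phi> (p a b)))"

text \<open>
  The free module \<open>Hv\<close> is \<open>'k poly\<close> with \<open>v = 1\<close> and action \<open>(*)\<close>.  In \<open>'k poly poly\<close> the inner
  indeterminate is \<open>\<partial>\<close> and the outer one is \<open>\<lambda>\<close>.  The product with \<open>v \<circ>\<^bsub>(\<lambda>)\<^esub> v = q(\<partial>, \<lambda>) v\<close> is, by
  sesqui-linearity, \<open>f(\<partial>)v \<circ>\<^bsub>(\<lambda>)\<^esub> g(\<partial>)v = f(-\<lambda>) g(\<partial>+\<lambda>) q(\<partial>, \<lambda>) v\<close>.
\<close>

definition rank_one_lprod ::
  "'k::field poly poly \<Rightarrow> 'k poly \<Rightarrow> 'k poly \<Rightarrow> 'k poly poly" where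
  "rank_one_lprod q f g =
    pcompose (map_poly (\<lambda>c. [:c:]) f) [:0, - 1:] *
    pcompose (map_poly (\<lambda>c. [:c:]) g) [:[:0, 1:], 1:] * q"

definition Cur1_lprod :: "'k::field poly \<Rightarrow> 'k poly \<Rightarrow> 'k poly poly" where
  "Cur1_lprod = rank_one_lprod 1"

definition V_lprod :: "'k::field \<Rightarrow> 'k poly \<Rightarrow> 'k poly \<Rightarrow> 'k poly poly" where
  "V_lprod \<alpha> = rank_one_lprod [:[:\<alpha>, 1:], 1:]"

lemma rank_one_lprod_generator: "rank_one_lprod q 1 1 = q"
  by (simp add: rank_one_lprod_def map_poly_1 pcompose_1 flip: one_pCons)

lemma map_poly_mult_const: "map_poly ((*) c) p = smult c (p :: 'a::comm_semiring_0 poly)"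
  by (intro poly_eqI) (simp add: coeff_map_poly)

lemma conformal_algebra_rank_one:
  "conformal_algebra (*) (rank_one_lprod (q :: 'k::field poly poly))"
proof -
  have add: "map_poly (\<lambda>c. [:c:]) (f + g) = map_poly (\<lambda>c. [:c:]) f + map_poly (\<lambda>c. [:c:]) g"
    for f g :: "'k poly"
    by (intro poly_eqI) (simp add: coeff_map_poly)
  have smult: "map_poly (\<lambda>c. [:c:]) (smult r f) = smult [:r:] (map_poly (\<lambda>c. [:c:]) f)"
    for r and f :: "'k poly"
    by (rule poly_eqI) (simp add: coeff_map_poly mult.commute)
  show ?thesis
    by unfold_locales
      (simp_all add: rank_one_lprod_def add smult pcompose_add pcompose_smult pcompose_pCons
        map_poly_pCons map_poly_mult_const algebra_simps)
qed

end

theory Submission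
  imports Defs
begin

text \<open>
  For \<open>s \<in> k\<close> let \<open>L\<^sub>a(s)\<close> be the operator \<open>b \<mapsto> a \<circ>\<^bsub>(s)\<^esub> b\<close> and \<open>R\<^sub>c(s)\<close> the operator
  \<open>a \<mapsto> {a \<circ>\<^bsub>(s)\<^esub> c}\<close> on \<open>V\<close>.  In these terms the Novikov identities say that all \<open>R\<^sub>c(s)\<close> commute
  (\<open>R_commute\<close>) and that \<open>[L\<^sub>a(s), R\<^sub>c(t)]\<close> is a polynomial in such operators (\<open>bracket_L_R\<close>).  So the
  bicommutant \<open>calR\<close> of the right multiplications is a commutative algebra on which commutation with
  each \<open>L\<^sub>a(s)\<close>, and with \<open>\<partial>\<close>, is a derivation.  In characteristic zero derivations preserve nilpotency,
  and they always kill idempotents.  If a set of operators in \<open>calR\<close> is stable under these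
  derivations, its image generates an ideal of \<open>V\<close>; and since
  right multiplications commute with it, the square of that ideal is controlled by the products of
  the operators.

  Semisimplicity enters through the absence of ideals with zero multiplication.  It makes \<open>V\<close>
  torsion-free over \<open>H\<close> and its left annihilator zero, and it forces every nilpotent semilinear
  operator in \<open>calR\<close> to vanish (\<open>calR_reduced\<close>).  An \<open>H\<close>-linear operator \<open>T\<close> in \<open>calR\<close> is
  algebraic over \<open>k\<close> (\<open>algebraic\<close>): finite rank gives a relation with coefficients in \<open>H\<close>, and since
  \<open>R\<^sub>c(\<lambda>)\<close> shifts \<open>\<partial>\<close> by \<open>\<lambda>\<close>, its coefficient at the highest power of \<open>\<partial>\<close> is already nilpotent at \<open>T\<close>.
  Hence idempotents split \<open>V\<close> into finitely many ideals on each of which the \<open>H\<close>-linear operators in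
  \<open>calR\<close> are scalars (\<open>primitive_decomposition\<close>).

  On such a component, let \<open>m\<close> be the lowest power of \<open>\<lambda>\<close> with a nonzero coefficient in some \<open>R\<^sub>c(\<lambda>)\<close>.
  This coefficient is a scalar, and the next one is, up to normalisation, an operator \<open>t\<close> with
  \<open>[t, \<partial>] = 1\<close>.  Integrating with respect to \<open>t\<close> shows that all coefficients of all \<open>R\<^sub>c(\<lambda>)\<close> are
  polynomials in \<open>t\<close>; formally \<open>R\<^sub>c(\<lambda>) = f\<^sub>c(\<lambda>) exp(\<lambda>t)\<close>.  As \<open>R\<^sub>c(\<lambda>)w\<close> is polynomial in \<open>\<lambda>\<close>, the operator
  \<open>t\<close> is locally finite and, after a shift by a scalar, kills a nonzero vector \<open>u\<close>.  Then
  \<open>R\<^sub>c(s)u = f\<^sub>c(s)u\<close> and \<open>t L\<^sub>a(s)u = g\<^sub>a(s)u\<close> with polynomials \<open>f\<^sub>c\<close> and \<open>g\<^sub>a\<close>.  The identity for \<open>[L, R]\<close>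
  expresses \<open>f\<close> and \<open>g\<close> of a product through \<open>f\<close> and \<open>g\<close> of the factors, and it makes \<open>f\<^sub>a + x g\<^sub>a\<close>
  proportional to \<open>g\<^sub>a\<close> (\<open>proportional\<close>): either \<open>g = 0\<close>, or \<open>f\<^sub>a = (\<alpha> - x) g\<^sub>a\<close> for all \<open>a\<close>.  The common
  kernel of \<open>f\<close> and \<open>g\<close> on the component is an ideal with zero multiplication, so \<open>f\<close> or \<open>g\<close> embeds the
  component into \<open>k[x]\<close> with \<open>\<partial>\<close> acting as \<open>-x\<close>.  The image is an ideal of \<open>k[x]\<close>, and the formula for products
  excludes a common root, so it is all of \<open>k[x]\<close>.  The preimage of \<open>1\<close> is a free generator, with the
  product of \<open>Cur\<^sub>1\<close> in the first case and that of \<open>V\<^sub>\<alpha>\<close> in the second.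
\<close>

section \<open>Additive operators\<close>

text \<open>
  Additive operators form a ring, in which commutators are computed by ring identities.  The zero
  group is included, so the sort of this ring does not demand \<open>0 \<noteq> 1\<close>.
\<close>

typedef (overloaded) 'v endo = "{f :: 'v::ab_group_add \<Rightarrow> 'v. \<forall>x y. f (x + y) = f x + f y}"
  morphisms app Endo
  by (rule exI[of _ "\<lambda>x. x"]) simp

lemma app_Endo: "(\<And>x y. f (x + y) = f x + f y) \<Longrightarrow> app (Endo f) = f"
  by (simp add: Endo_inverse)

lemma app_add: "app X (x + y) = app X x + app X y"
  using app[of X] by simp

lemma endo_eqI: "(\<And>x. app X x = app Y x) \<Longrightarrow> X = Y"
  by (metis app_inject ext)

lemma app_zero [simp]: "app X 0 = 0"
  using app_add[of X 0 0] by simp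

lemma app_minus: "app X (- x) = - app X x"
  using app_add[of X x "- x"] by (simp add: eq_neg_iff_add_eq_0 add.commute)

lemma app_diff: "app X (x - y) = app X x - app X y"
  using app_add[of X x "- y"] by (simp add: app_minus)

lemma app_sum: "app X (sum f A) = (\<Sum>i\<in>A. app X (f i))"
  by (induction A rule: infinite_finite_induct) (simp_all add: app_add)

instantiation endo :: (ab_group_add) "{ring, monoid_mult}"
begin

definition "0 = Endo (\<lambda>_. 0)"
definition "1 = Endo (\<lambda>x. x)"
definition "X + Y = Endo (\<lambda>x. app X x + app Y x)"
definition "- X = Endo (\<lambda>x. - app X x)"
definition "X - Y = Endo (\<lambda>x. app X x - app Y x)" for X Y :: "'a endo"
definition "X * Y = Endo (\<lambda>x. app X (app Y x))"

lemma app_ring [simp]: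
  "app 0 x = (0::'a)" "app 1 x = (x::'a)" "app (X + Y) x = app X x + (app Y x :: 'a)"
  "app (- X) x = - (app X x :: 'a)" "app (X - Y) x = app X x - (app Y x :: 'a)"
  "app (X * Y) x = app X (app Y x :: 'a)"
  by (simp_all add: zero_endo_def one_endo_def plus_endo_def uminus_endo_def minus_endo_def
      times_endo_def app_Endo app_add)

instance
  by standard (rule endo_eqI; simp add: app_add algebra_simps)+

end

lemma app_sum_left: "app (sum X A) v = (\<Sum>i\<in>A. app (X i) v)"
  by (induction A rule: infinite_finite_induct) simp_all

section \<open>Commutants\<close>

definition commutant :: "'a::times set \<Rightarrow> 'a set" where
  "commutant S = {y. \<forall>x\<in>S. x * y = y * x}"

definition bracket :: "'a::ring \<Rightarrow> 'a \<Rightarrow> 'a" where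
  "bracket x y = x * y - y * x"

lemma commutantD: "y \<in> commutant S \<Longrightarrow> x \<in> S \<Longrightarrow> x * y = y * x"
  by (simp add: commutant_def)

lemma bicommutant_superset: "S \<subseteq> commutant (commutant S)"
  by (auto simp: commutant_def)

text \<open>
  Thus the bicommutant of a set of commuting elements is commutative.
\<close>

lemma bicommutant_subset_commutant:
  assumes "S \<subseteq> commutant S"
  shows "commutant (commutant S) \<subseteq> commutant S"
  using assms unfolding commutant_def by blast

lemma commutant_mult:
  "x \<in> commutant S \<Longrightarrow> y \<in> commutant S \<Longrightarrow> x * y \<in> commutant (S :: 'a::ring set)"
  unfolding commutant_def by (smt (verit, best) mem_Collect_eq mult.assoc)

lemma commutant_add:
  "x \<in> commutant S \<Longrightarrow> y \<in> commutant S \<Longrightarrow> x + y \<in> commutant (S :: 'a::ring set)"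
  by (simp add: commutant_def algebra_simps)

lemma commutant_diff:
  "x \<in> commutant S \<Longrightarrow> y \<in> commutant S \<Longrightarrow> x - y \<in> commutant (S :: 'a::ring set)"
  by (simp add: commutant_def algebra_simps)

lemma commutant_zero: "0 \<in> commutant (S :: 'a::ring set)"
  by (simp add: commutant_def)

lemma commutant_one: "1 \<in> commutant (S :: 'a::{ring,monoid_mult} set)"
  by (simp add: commutant_def)

lemma commutant_power:
  "x \<in> commutant S \<Longrightarrow> x ^ n \<in> commutant (S :: 'a::{ring,monoid_mult} set)"
  by (induction n) (simp_all add: commutant_one commutant_mult)

lemma bracket_mult: "bracket d (x * y) = bracket d x * y + x * bracket d y"
  by (simp add: bracket_def algebra_simps)

text \<open>
  By the Jacobi identity, a derivation that sends \<open>S\<close> into the bicommutant preserves the commutant,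
  and then the bicommutant.
\<close>

lemma bracket_bicommutant:
  assumes S: "\<And>x. x \<in> S \<Longrightarrow> bracket d x \<in> commutant (commutant S)"
    and x: "x \<in> commutant (commutant S)"
  shows "bracket d x \<in> commutant (commutant (S :: 'a::ring set))"
proof -
  have C: "bracket d y \<in> commutant S" if y: "y \<in> commutant S" for y
    unfolding commutant_def
  proof (standard, intro ballI)
    fix z assume z: "z \<in> S"
    have "z * y = y * z" "y * bracket d z = bracket d z * y"
      using commutantD[OF y z] commutantD[OF S[OF z] y] by simp_all
    then show "z * bracket d y = bracket d y * z"
      using bracket_mult[of d z y] bracket_mult[of d y z] by simp
  qed
  show ?thesis
    unfolding commutant_def[of "commutant S"]
  proof (standard, intro ballI)
    fix y assume y: "y \<in> commutant S"
    have "y * x = x * y" "bracket d y * x = x * bracket d y"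
      using commutantD[OF x y] commutantD[OF x C[OF y]] by simp_all
    then show "y * bracket d x = bracket d x * y"
      using bracket_mult[of d x y] bracket_mult[of d y x] by simp
  qed
qed

section \<open>Substituting elements of \<open>H\<close> for the indeterminates\<close>

context conformal_algebra
begin

definition peval :: "'k poly \<Rightarrow> 'v poly \<Rightarrow> 'v" where
  "peval h p = (\<Sum>n\<le>degree p. scale (h ^ n) (coeff p n))"

lemma peval_bound:
  assumes "degree p \<le> N"
  shows "peval h p = (\<Sum>n\<le>N. scale (h ^ n) (coeff p n))"
  unfolding peval_def
  by (rule sum.mono_neutral_left) (use assms in \<open>auto simp: coeff_eq_0\<close>)

lemma peval_0 [simp]: "peval h 0 = 0"
  by (simp add: peval_def)

lemma peval_add: "peval h (p + q) = peval h p + peval h q"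
proof -
  let ?N = "max (degree p) (degree q)"
  have "degree (p + q) \<le> ?N"
    by (rule degree_add_le) auto
  then show ?thesis
    by (simp add: peval_bound[of _ ?N] scale_right_distrib sum.distrib)
qed

lemma peval_minus: "peval h (- p) = - peval h p"
  using peval_add[of h p "- p"] by (simp add: eq_neg_iff_add_eq_0 add.commute)

lemma peval_diff: "peval h (p - q) = peval h p - peval h q"
  using peval_add[of h p "- q"] by (simp add: peval_minus)

lemma peval_pCons [simp]: "peval h (pCons a p) = a + scale h (peval h p)"
proof -
  have "peval h (pCons a p) = (\<Sum>n\<le>Suc (degree p). scale (h ^ n) (coeff (pCons a p) n))"
    by (rule peval_bound) (rule degree_pCons_le)
  also have "\<dots> = a + (\<Sum>n\<le>degree p. scale (h ^ Suc n) (coeff p n))"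
    by (subst sum.atMost_Suc_shift) simp
  finally show ?thesis
    by (simp add: peval_def scale_sum_right)
qed

lemma peval_map:
  assumes "f 0 = 0" "\<And>x y. f (x + y) = f x + f y" "\<And>x. f (scale h x) = scale h (f x)"
  shows "peval h (map_poly f p) = f (peval h p)"
  by (induction p) (simp_all add: assms map_poly_pCons)

lemma peval_map_scale [simp]: "peval h (map_poly (scale g) p) = scale g (peval h p)"
  by (rule peval_map) (simp_all add: scale_right_distrib mult.commute)

text \<open>
  The value of an element of \<open>V[\<lambda>, \<mu>]\<close> at \<open>\<lambda> = h\<close>, \<open>\<mu> = g\<close>.  Substituting elements of \<open>H\<close>, and not
  only scalars, makes it possible to read the Novikov identities as identities between operators.
\<close>

definition peval2 :: "'k poly \<Rightarrow> 'k poly \<Rightarrow> 'v poly poly \<Rightarrow> 'v" where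
  "peval2 h g P = (\<Sum>n\<le>degree P. scale (g ^ n) (peval h (coeff P n)))"

lemma peval2_bound:
  assumes "degree P \<le> N"
  shows "peval2 h g P = (\<Sum>n\<le>N. scale (g ^ n) (peval h (coeff P n)))"
  unfolding peval2_def
  by (rule sum.mono_neutral_left) (use assms in \<open>auto simp: coeff_eq_0\<close>)

lemma peval2_0 [simp]: "peval2 h g 0 = 0"
  by (simp add: peval2_def)

lemma peval2_add: "peval2 h g (P + Q) = peval2 h g P + peval2 h g Q"
proof -
  let ?N = "max (degree P) (degree Q)"
  have "degree (P + Q) \<le> ?N"
    by (rule degree_add_le) auto
  then show ?thesis
    by (simp add: peval2_bound[of _ ?N] scale_right_distrib sum.distrib peval_add)
qed

lemma peval2_minus: "peval2 h g (- P) = - peval2 h g P"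
  using peval2_add[of h g P "- P"] by (simp add: eq_neg_iff_add_eq_0 add.commute)

lemma peval2_diff: "peval2 h g (P - Q) = peval2 h g P - peval2 h g Q"
  using peval2_add[of h g P "- Q"] by (simp add: peval2_minus)

lemma peval2_sum: "peval2 h g (sum f A) = (\<Sum>i\<in>A. peval2 h g (f i))"
  by (induction A rule: infinite_finite_induct) (simp_all add: peval2_add)

lemma peval2_pCons [simp]: "peval2 h g (pCons p P) = peval h p + scale g (peval2 h g P)"
proof -
  have "peval2 h g (pCons p P) = (\<Sum>n\<le>Suc (degree P). scale (g ^ n) (peval h (coeff (pCons p P) n)))"
    by (rule peval2_bound) (rule degree_pCons_le)
  also have "\<dots> = peval h p + (\<Sum>n\<le>degree P. scale (g ^ Suc n) (peval h (coeff P n)))"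
    by (subst sum.atMost_Suc_shift) simp
  finally show ?thesis
    by (simp add: peval2_def scale_sum_right)
qed

lemma peval2_mult_lam [simp]: "peval2 h g (mult_lam P) = scale h (peval2 h g P)"
  unfolding mult_lam_def
  by (induction P) (simp_all add: map_poly_pCons scale_right_distrib mult.commute)

lemma peval2_mult_mu [simp]: "peval2 h g (mult_mu P) = scale g (peval2 h g P)"
  by (simp add: mult_mu_def)

lemma peval2_mult_del [simp]: "peval2 h g (mult_del P) = scale [:0, 1:] (peval2 h g P)"
  unfolding mult_del_def
  by (induction P) (simp_all add: map_poly_pCons scale_right_distrib mult.commute)

lemma peval2_subst_poly:
  assumes "\<And>P. peval2 h g (T P) = scale t (peval2 h g P)"
  shows "peval2 h g (subst_poly T e p) = (\<Sum>n\<le>degree p. scale (t ^ n) (peval2 h g (e (coeff p n))))"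
proof -
  have "peval2 h g ((T ^^ n) P) = scale (t ^ n) (peval2 h g P)" for n P
    by (induction n) (simp_all add: assms)
  then show ?thesis
    by (simp add: subst_poly_def peval2_sum)
qed

text \<open>
  The element \<open>prod_at a h b\<close> is \<open>a \<circ>\<^bsub>(h)\<^esub> b\<close> for \<open>h \<in> H\<close>.  Taking \<open>h\<close> to be a scalar \<open>s\<close> gives left
  multiplications, and \<open>h = -\<partial>-s\<close> gives right multiplications.
\<close>

definition prod_at :: "'v \<Rightarrow> 'k poly \<Rightarrow> 'v \<Rightarrow> 'v" where
  "prod_at a h b = peval h (lprod a b)"

lemma peval2_lprod_at:
  assumes "\<And>P. peval2 h g (T P) = scale t (peval2 h g P)"
  shows "peval2 h g (lprod_at T a b) = prod_at a t b"
  by (simp add: lprod_at_def peval2_subst_poly[OF assms] prod_at_def peval_def)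

lemma prod_at_add_left: "prod_at (a + b) h c = prod_at a h c + prod_at b h c"
  by (simp add: prod_at_def lprod_add_left peval_add)

lemma prod_at_add_right: "prod_at a h (b + c) = prod_at a h b + prod_at a h c"
  by (simp add: prod_at_def lprod_add_right peval_add)

lemma prod_at_zero_left [simp]: "prod_at 0 h c = 0"
  using prod_at_add_left[of 0 0 h c] by simp

lemma prod_at_zero_right [simp]: "prod_at a h 0 = 0"
  using prod_at_add_right[of a h 0 0] by simp

lemma prod_at_sum_left: "prod_at (sum f A) h c = (\<Sum>i\<in>A. prod_at (f i) h c)"
  by (induction A rule: infinite_finite_induct) (simp_all add: prod_at_add_left)

lemma prod_at_sum_right: "prod_at a h (sum f A) = (\<Sum>i\<in>A. prod_at a h (f i))"
  by (induction A rule: infinite_finite_induct) (simp_all add: prod_at_add_right)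

lemma scale_pCons: "scale (pCons c h) a = scale [:c:] a + scale [:0, 1:] (scale h a)"
proof -
  have "pCons c h = [:c:] + [:0, 1:] * h"
    by simp
  then show ?thesis
    by (simp only: scale_left_distrib scale_scale)
qed

lemma prod_at_scale_left: "prod_at (scale h a) g b = scale (pcompose h (- g)) (prod_at a g b)"
proof (induction h)
  case (pCons c h)
  have "prod_at (scale (pCons c h) a) g b
      = scale [:c:] (prod_at a g b) - scale g (prod_at (scale h a) g b)"
    unfolding scale_pCons[of c h] prod_at_add_left
    unfolding prod_at_def lprod_scalar_left lprod_del_left
    by (simp add: peval_minus)
  then show ?case
    using pCons by (simp add: pcompose_pCons scale_left_distrib scale_left_diff_distrib)
qed (simp add: prod_at_def[of 0])

lemma prod_at_scale_right:
  "prod_at a g (scale h b) = scale (pcompose h ([:0, 1:] + g)) (prod_at a g b)"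
proof (induction h)
  case (pCons c h)
  have "prod_at a g (scale (pCons c h) b)
      = scale [:c:] (prod_at a g b) + scale ([:0, 1:] + g) (prod_at a g (scale h b))"
    unfolding scale_pCons[of c h] prod_at_add_right
    unfolding prod_at_def lprod_scalar_right lprod_del_right
    by (simp add: peval_add scale_left_distrib)
  then show ?case
    using pCons by (simp add: pcompose_pCons scale_left_distrib)
qed simp

section \<open>The Novikov identities for operators\<close>

lemma novikov_left_symmetric:
  assumes novikov
  shows "(\<Sum>n\<le>degree (lprod a b). scale (h ^ n) (prod_at (coeff (lprod a b) n) (h + g) c))
      - (\<Sum>n\<le>degree (lprod b c). scale (g ^ n) (prod_at a h (coeff (lprod b c) n)))
    = (\<Sum>n\<le>degree (lprod b a). scale (g ^ n) (prod_at (coeff (lprod b a) n) (h + g) c))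
      - (\<Sum>n\<le>degree (lprod a c). scale (h ^ n) (prod_at b g (coeff (lprod a c) n)))"
proof -
  have T: "peval2 h g (mult_lam P + mult_mu P) = scale (h + g) (peval2 h g P)" for P
    by (simp add: peval2_add scale_left_distrib)
  have "subst_poly mult_lam (\<lambda>x. lprod_at (\<lambda>p. mult_lam p + mult_mu p) x c) (lprod a b)
      - subst_poly mult_mu (\<lambda>x. lprod_at mult_lam a x) (lprod b c)
      = subst_poly mult_mu (\<lambda>x. lprod_at (\<lambda>p. mult_lam p + mult_mu p) x c) (lprod b a)
      - subst_poly mult_lam (\<lambda>x. lprod_at mult_mu b x) (lprod a c)"
    using assms unfolding novikov_def by blast
  from arg_cong[OF this, of "peval2 h g"] show ?thesis
    by (simp add: peval2_diff peval2_subst_poly[OF peval2_mult_lam]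
        peval2_subst_poly[OF peval2_mult_mu] peval2_lprod_at[OF T]
        peval2_lprod_at[OF peval2_mult_lam] peval2_lprod_at[OF peval2_mult_mu])
qed

lemma novikov_right_commutative:
  assumes novikov
  shows "(\<Sum>n\<le>degree (lprod a b). scale (h ^ n) (prod_at (coeff (lprod a b) n) g c))
    = (\<Sum>n\<le>degree (lprod a c). scale (h ^ n) (prod_at (coeff (lprod a c) n) (h - g - [:0, 1:]) b))"
proof -
  have T: "peval2 h g (- mult_del P - (mult_mu P - mult_lam P))
      = scale (h - g - [:0, 1:]) (peval2 h g P)" for P
    by (simp add: peval2_diff peval2_minus scale_left_diff_distrib)
  have "subst_poly mult_lam (\<lambda>x. lprod_at mult_mu x c) (lprod a b)
      = subst_poly mult_lam (\<lambda>x. curly_at (\<lambda>p. mult_mu p - mult_lam p) x b) (lprod a c)"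
    using assms unfolding novikov_def by blast
  from arg_cong[OF this, of "peval2 h g"] show ?thesis
    unfolding curly_at_def
    by (simp add: peval2_subst_poly[OF peval2_mult_lam] peval2_lprod_at[OF T]
        peval2_lprod_at[OF peval2_mult_mu])
qed

definition sc :: "'k poly \<Rightarrow> 'v endo" where
  "sc h = Endo (scale h)"

definition L :: "'v \<Rightarrow> 'k \<Rightarrow> 'v endo" where
  "L a s = Endo (prod_at a [:s:])"

definition R :: "'v \<Rightarrow> 'k \<Rightarrow> 'v endo" where
  "R c s = Endo (\<lambda>a. prod_at a [:- s, - 1:] c)"

abbreviation del :: "'v endo" where
  "del \<equiv> sc [:0, 1:]"

abbreviation kc :: "'k \<Rightarrow> 'v endo" where
  "kc c \<equiv> sc [:c:]"

lemma app_sc [simp]: "app (sc h) v = scale h v"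
  by (simp add: sc_def app_Endo scale_right_distrib)

lemma app_L: "app (L a s) b = prod_at a [:s:] b"
  by (simp add: L_def app_Endo prod_at_add_right)

lemma app_R: "app (R c s) a = prod_at a [:- s, - 1:] c"
  by (simp add: R_def app_Endo prod_at_add_left)

lemma sc_mult: "sc (h * g) = sc h * sc g"
  by (rule endo_eqI) simp

lemma sc_add: "sc (h + g) = sc h + sc g"
  by (rule endo_eqI) (simp add: scale_left_distrib)

lemma sc_0 [simp]: "sc 0 = 0" and sc_1 [simp]: "sc 1 = 1"
  by (rule endo_eqI; simp)+

lemma sc_commute: "sc h * sc g = sc g * sc h"
  by (simp flip: sc_mult add: mult.commute)

lemma kc_mult: "kc (a * b) = kc a * kc b"
  by (simp flip: sc_mult add: mult.commute)

lemma kc_add: "kc (a + b) = kc a + kc b"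
  by (simp flip: sc_add)

lemma kc_1 [simp]: "kc 1 = 1"
  by (simp flip: one_pCons)

lemma R_add: "R (c + d) s = R c s + R d s"
  by (rule endo_eqI) (simp add: app_R prod_at_add_right)

lemma L_add: "L (c + d) s = L c s + L d s"
  by (rule endo_eqI) (simp add: app_L prod_at_add_left)

lemma R_scale: "R (scale h c) s = kc (poly h (- s)) * R c s"
  by (rule endo_eqI) (simp add: app_R prod_at_scale_right pcompose_pCons_0)

lemma L_scale: "L (scale h a) s = kc (poly h (- s)) * L a s"
  by (rule endo_eqI) (simp add: app_L prod_at_scale_left pcompose_pCons_0)

lemma R_sc: "R c s * sc h = sc (pcompose h [:s, 1:]) * R c s"
  by (rule endo_eqI) (simp add: app_R prod_at_scale_left)

lemma L_sc: "L a s * sc h = sc (pcompose h [:s, 1:]) * L a s"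
  by (rule endo_eqI) (simp add: app_L prod_at_scale_right)

lemma pcompose_power: "pcompose (p ^ n) q = pcompose p q ^ n" for p q :: "'k poly"
  by (induction n) (simp_all add: pcompose_mult pcompose_1)

text \<open>
  The compositions of multiplications in the form in which they occur in the Novikov identities: by
  sesqui-linearity a factor \<open>(-\<partial>-s)\<^sup>n\<close> inside a product at \<open>-\<partial>-t\<close> can be moved out as
  \<open>(-\<partial>-s-t)\<^sup>n\<close>.
\<close>

lemma app_R_R:
  "app (R d t * R c s) a = (\<Sum>n\<le>degree (lprod a c). scale ([:- s - t, - 1:] ^ n)
      (prod_at (coeff (lprod a c) n) [:- t, - 1:] d))"
proof -
  have "[:- s:] + [:- t, - 1:] = [:- s - t, - 1:]"
    by simp
  then show ?thesis
    by (simp add: app_R prod_at_def[of a] peval_def prod_at_sum_left prod_at_scale_left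
        pcompose_power pcompose_pCons)
qed

lemma app_R_L:
  "app (R c t * L a s) b = (\<Sum>n\<le>degree (lprod a b). scale ([:s:] ^ n)
      (prod_at (coeff (lprod a b) n) [:- t, - 1:] c))"
  by (simp add: app_R app_L prod_at_def[of a] peval_def prod_at_sum_left prod_at_scale_left
        pcompose_power)

lemma app_L_R:
  "app (L a s * R c t) b = (\<Sum>n\<le>degree (lprod b c). scale ([:- s - t, - 1:] ^ n)
      (prod_at a [:s:] (coeff (lprod b c) n)))"
  by (simp add: app_R app_L prod_at_def[of b] peval_def prod_at_sum_right prod_at_scale_right
      pcompose_power pcompose_pCons minus_diff_commute[where a = s and b = t])

lemma app_R_of_L:
  "app (R (app (L a s) c) u) b = (\<Sum>n\<le>degree (lprod a c). scale ([:s:] ^ n)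
      (prod_at b [:- u, - 1:] (coeff (lprod a c) n)))"
  by (simp add: app_R app_L prod_at_def[of a] peval_def prod_at_sum_right prod_at_scale_right
        pcompose_power)

text \<open>
  Right commutativity at \<open>\<lambda> = -\<partial>-s-t\<close>, \<open>\<mu> = -\<partial>-t\<close>.
\<close>

lemma R_commute:
  assumes novikov
  shows "R b s * R c t = R c t * R b s"
proof (rule endo_eqI)
  fix a
  have *: "[:- s - t, - 1:] - [:- t, - 1:] - [:0, 1:] = [:- s, - 1::'k:]" "- t - s = - s - t"
    by simp_all
  show "app (R b s * R c t) a = app (R c t * R b s) a"
    unfolding app_R_R *(2)
    using novikov_right_commutative[OF assms,
        where a = a and b = b and c = c and h = "[:- s - t, - 1:]" and g = "[:- t, - 1:]"]
    unfolding *(1) by (rule sym)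
qed

text \<open>
  Right commutativity at \<open>\<lambda> = s-t\<close>, \<open>\<mu> = -\<partial>-t\<close>.
\<close>

lemma L_of_R:
  assumes novikov
  shows "app (L (app (R c t) a) s) b = app (R c t) (app (L a (s - t)) b)"
proof -
  have *: "[:s - t:] - [:- t, - 1:] - [:0, 1:] = [:s:]"
    by simp
  have "app (L (app (R c t) a) s) b = (\<Sum>n\<le>degree (lprod a c). scale ([:s - t:] ^ n)
      (prod_at (coeff (lprod a c) n) [:s:] b))"
    by (simp add: app_R app_L prod_at_def[of a] peval_def prod_at_sum_left prod_at_scale_left
        pcompose_power pcompose_pCons)
  then show ?thesis
    using app_R_L[of c t a "s - t" b] novikov_right_commutative[OF assms,
        where a = a and b = b and c = c and h = "[:s - t:]" and g = "[:- t, - 1:]"]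
    unfolding * by simp
qed

text \<open>
  Left symmetry at \<open>\<lambda> = s\<close>, \<open>\<mu> = -\<partial>-s-t\<close>.
\<close>

lemma bracket_L_R:
  assumes novikov
  shows "bracket (L a s) (R c t) = R (app (L a s) c) (s + t) - R c t * R a s"
proof (rule endo_eqI)
  fix b
  have *: "[:s:] + [:- s - t, - 1:] = [:- t, - 1:]" "- (s + t) = - s - t"
    by simp_all
  show "app (bracket (L a s) (R c t)) b = app (R (app (L a s) c) (s + t) - R c t * R a s) b"
    using novikov_left_symmetric[OF assms,
        where a = a and b = b and c = c and h = "[:s:]" and g = "[:- s - t, - 1:]"]
    unfolding bracket_def app_ring(5) app_R_R app_R_L app_L_R app_R_of_L * by (simp add: algebra_simps)
qed

end

section \<open>Coefficients of right multiplications\<close>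

locale novikov_algebra = conformal_algebra scale lprod
  for scale :: "'k::field_char_0 poly \<Rightarrow> 'v::ab_group_add \<Rightarrow> 'v"
    and lprod :: "'v \<Rightarrow> 'v \<Rightarrow> 'v poly" +
  assumes novikov: novikov
begin

text \<open>
  Subspaces over the field are needed besides \<open>H\<close>-submodules because of lines spanned by one vector.
\<close>

definition k_subspace :: "'v set \<Rightarrow> bool" where
  "k_subspace I \<longleftrightarrow> 0 \<in> I \<and> (\<forall>x\<in>I. \<forall>y\<in>I. x + y \<in> I) \<and> (\<forall>c. \<forall>x\<in>I. scale [:c:] x \<in> I)"

lemma subspace_imp_k_subspace: "subspace I \<Longrightarrow> k_subspace I"
  by (auto simp: k_subspace_def subspace_def)

lemma k_subspace_0: "k_subspace {0}"
  by (simp add: k_subspace_def)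

lemma k_subspace_diff: "k_subspace I \<Longrightarrow> x \<in> I \<Longrightarrow> y \<in> I \<Longrightarrow> x - y \<in> I"
  unfolding k_subspace_def
  by (metis (no_types) add_uminus_conv_diff minus_pCons minus_zero one_pCons scale_minus_left scale_one)

lemma k_subspace_sum: "k_subspace I \<Longrightarrow> (\<And>i. i \<in> A \<Longrightarrow> f i \<in> I) \<Longrightarrow> sum f A \<in> I"
  by (induction A rule: infinite_finite_induct) (auto simp: k_subspace_def)

lemma two_power_eq_iff: "(2::'k) ^ m = 2 ^ n \<longleftrightarrow> m = n"
proof -
  have "(2::'k) ^ m = 2 ^ n \<longleftrightarrow> of_nat (2 ^ m) = (of_nat (2 ^ n) :: 'k)"
    by simp
  also have "\<dots> \<longleftrightarrow> m = n"
    by (subst of_nat_eq_iff) simp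
  finally show ?thesis .
qed

text \<open>
  A replacement for the Vandermonde determinant: \<open>p(2s) - 2\<^sup>d p(s)\<close> has degree less than \<open>d\<close>
  if \<open>p\<close> has degree \<open>d\<close>, and it has the coefficients of \<open>p\<close> up to nonzero factors.
\<close>

lemma coefficients_in_k_subspace:
  assumes "k_subspace I" "\<And>s. (\<Sum>n\<le>d. scale [:s ^ n:] (x n)) \<in> I" "n \<le> d"
  shows "x n \<in> I"
  using assms(2,3)
proof (induction d arbitrary: x n)
  case 0
  show ?case using 0(1)[of 0] 0(2) by (simp flip: one_pCons)
next
  case (Suc d)
  define y where "y n = scale [:2 ^ n - 2 ^ Suc d:] (x n)" for n
  have low: "x m \<in> I" if m: "m \<le> d" for m
  proof -
    have "y m \<in> I"
    proof (rule Suc.IH[OF _ m])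
      fix s :: 'k
      have "(\<Sum>n\<le>d. scale [:s ^ n:] (y n)) = (\<Sum>n\<le>Suc d. scale [:s ^ n:] (y n))"
        by (simp add: y_def)
      also have "\<dots> = (\<Sum>n\<le>Suc d. scale [:(2 * s) ^ n:] (x n))
          - scale [:2 ^ Suc d:] (\<Sum>n\<le>Suc d. scale [:s ^ n:] (x n))"
        unfolding scale_sum_right sum_subtractf[symmetric]
        by (rule sum.cong) (simp_all add: y_def algebra_simps power_mult_distrib
            flip: scale_left_diff_distrib)
      also have "\<dots> \<in> I"
        using Suc.prems(1)[of "2 * s"] Suc.prems(1)[of s] assms(1)
        by (intro k_subspace_diff) (simp_all del: sum.atMost_Suc power_Suc add: k_subspace_def)
      finally show "(\<Sum>n\<le>d. scale [:s ^ n:] (y n)) \<in> I" .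
    qed
    then have "scale [:1 / (2 ^ m - 2 ^ Suc d):] (y m) \<in> I"
      using assms(1) by (simp add: k_subspace_def)
    moreover have "(2::'k) ^ m - 2 ^ Suc d \<noteq> 0"
      using m two_power_eq_iff[of m "Suc d"] by (auto simp del: power_Suc)
    ultimately show ?thesis
      by (simp add: y_def del: power_Suc flip: one_pCons)
  qed
  have "(\<Sum>n\<le>Suc d. scale [:1 ^ n:] (x n)) - (\<Sum>n\<le>d. scale [:1 ^ n:] (x n)) \<in> I"
    by (intro k_subspace_diff[OF assms(1)] k_subspace_sum[OF assms(1)] Suc.prems(1)[of 1])
      (use assms(1) low in \<open>simp add: k_subspace_def\<close>)
  then have "x (Suc d) \<in> I"
    by (simp flip: one_pCons)
  then show ?case
    using low Suc.prems(2) le_Suc_eq by blast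
qed

lemma peval_const: "peval [:s:] p = (\<Sum>n\<le>degree p. scale [:s ^ n:] (coeff p n))"
  by (simp add: peval_def poly_const_pow)

lemma coeff_in_k_subspace:
  assumes "k_subspace I" "\<And>s. peval [:s:] p \<in> I"
  shows "coeff p n \<in> I"
proof (cases "n \<le> degree p")
  case True
  show ?thesis
    by (rule coefficients_in_k_subspace[OF assms(1) _ True]) (use assms(2) in \<open>simp add: peval_const\<close>)
next
  case False
  then show ?thesis
    using assms(1) by (simp add: coeff_eq_0 k_subspace_def)
qed

lemma poly_eq_by_values: "(\<And>s. peval [:s:] p = peval [:s:] q) \<Longrightarrow> p = q"
  using coeff_in_k_subspace[OF k_subspace_0, of "p - q"] by (intro poly_eqI) (simp add: peval_diff)

text \<open>
  \<open>curly p\<close> is \<open>p(-\<partial>-\<lambda>)\<close>, determined by its values.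
\<close>

definition curly :: "'v poly \<Rightarrow> 'v poly" where
  "curly p = (SOME q. \<forall>h. peval h q = peval (- [:0, 1:] - h) p)"

lemma peval_curly: "peval h (curly p) = peval (- [:0, 1:] - h) p"
proof -
  have "\<exists>q. \<forall>h. peval h q = peval (- [:0, 1:] - h) p"
  proof (induction p)
    case 0
    show ?case by (intro exI[of _ 0]) simp
  next
    case (pCons a p)
    then obtain q where q: "\<And>h. peval h q = peval (- [:0, 1:] - h) p"
      by blast
    have "peval h ([:a:] - map_poly (scale [:0, 1:]) q - pCons 0 q) = peval (- [:0, 1:] - h) (pCons a p)" for h
      by (simp add: peval_diff q scale_left_diff_distrib flip: scale_minus_left del: minus_pCons)
    then show ?case by blast
  qed
  from someI_ex[OF this] show ?thesis
    unfolding curly_def by blast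
qed

lemma curly_add: "curly (p + q) = curly p + curly q"
  by (rule poly_eq_by_values) (simp add: peval_curly peval_add)

text \<open>\<open>right_poly c a\<close> is \<open>{a \<circ>\<^bsub>(\<lambda>)\<^esub> c}\<close>, and \<open>Rm c m\<close> is the coefficient of \<open>\<lambda>\<^sup>m\<close> in \<open>a \<mapsto> {a \<circ>\<^bsub>(\<lambda>)\<^esub> c}\<close>.\<close>

definition right_poly :: "'v \<Rightarrow> 'v \<Rightarrow> 'v poly" where
  "right_poly c a = curly (lprod a c)"

definition Rm :: "'v \<Rightarrow> nat \<Rightarrow> 'v endo" where
  "Rm c m = Endo (\<lambda>a. coeff (right_poly c a) m)"

lemma app_Rm: "app (Rm c m) a = coeff (right_poly c a) m"
  by (simp add: Rm_def app_Endo right_poly_def lprod_add_left curly_add)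

lemma app_R_eq: "app (R c s) a = peval [:s:] (right_poly c a)"
  by (simp add: app_R right_poly_def peval_curly prod_at_def)

lemma app_L_eq: "app (L a s) c = peval [:- s, - 1:] (right_poly c a)"
  by (simp add: app_L right_poly_def peval_curly prod_at_def)

lemma app_L_peval: "app (L a s) c = peval [:s:] (lprod a c)"
  by (simp add: app_L prod_at_def)

lemma R_eq_0_iff: "(\<forall>s. app (R c s) a = 0) \<longleftrightarrow> lprod a c = 0"
proof
  assume "\<forall>s. app (R c s) a = 0"
  then have "right_poly c a = 0"
    by (intro poly_eq_by_values) (simp add: app_R_eq)
  then have "peval [:s:] (lprod a c) = 0" for s
    using app_L_eq[of a s c] by (simp add: app_L_peval)
  then show "lprod a c = 0"
    by (intro poly_eq_by_values) simp
qed (simp add: app_R prod_at_def)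

section \<open>The bicommutant of the right multiplications\<close>

definition Rset :: "'v endo set" where
  "Rset = {R c s | c s. True} \<union> range kc"

text \<open>
  The bicommutant contains the coefficients of \<open>R\<^sub>c(\<lambda>)\<close> along with the values \<open>R\<^sub>c(s)\<close>; on all of \<open>V\<close>
  a coefficient need not be a finite combination of values, because the degree in \<open>\<lambda>\<close> is unbounded.
\<close>

definition calR :: "'v endo set" where
  "calR = commutant (commutant Rset)"

lemma Rset_commutes: "Rset \<subseteq> commutant Rset"
proof -
  have "kc a * R c s = R c s * kc a" for a c s
    by (simp add: R_sc)
  then show ?thesis
    unfolding commutant_def Rset_def by (auto simp: R_commute[OF novikov] sc_commute)
qed

lemma calR_commutant: "X \<in> calR \<Longrightarrow> X \<in> commutant Rset"
  using bicommutant_subset_commutant[OF Rset_commutes] by (auto simp: calR_def)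

lemma calR_commute: "X \<in> calR \<Longrightarrow> Y \<in> calR \<Longrightarrow> X * Y = Y * X"
  unfolding calR_def by (metis calR_commutant calR_def commutantD)

lemma R_in_calR: "R c s \<in> calR" and kc_in_calR: "kc a \<in> calR"
  using bicommutant_superset[of Rset] by (auto simp: calR_def Rset_def)

lemma calR_mult: "X \<in> calR \<Longrightarrow> Y \<in> calR \<Longrightarrow> X * Y \<in> calR"
  and calR_add: "X \<in> calR \<Longrightarrow> Y \<in> calR \<Longrightarrow> X + Y \<in> calR"
  and calR_diff: "X \<in> calR \<Longrightarrow> Y \<in> calR \<Longrightarrow> X - Y \<in> calR"
  and calR_0: "0 \<in> calR" and calR_1: "1 \<in> calR"
  and calR_power: "X \<in> calR \<Longrightarrow> X ^ n \<in> calR"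
  unfolding calR_def
  by (blast intro: commutant_mult commutant_add commutant_diff commutant_zero commutant_one
      commutant_power)+

lemma calR_kc: "X \<in> calR \<Longrightarrow> X * kc c = kc c * X"
  by (simp add: calR_commute kc_in_calR)

lemma calR_scale: "X \<in> calR \<Longrightarrow> app X (scale [:c:] v) = scale [:c:] (app X v)"
  using calR_kc[of X c] by (metis app_ring(6) app_sc)

text \<open>
  An operator \<open>Y\<close> that commutes with scalars and with all \<open>R\<^sub>c(s)\<close> commutes with the coefficients, since
  a polynomial is determined by its values.
\<close>

lemma Rm_in_calR: "Rm c m \<in> calR"
  unfolding calR_def commutant_def[of "commutant Rset"]
proof (standard, intro ballI endo_eqI)
  fix Y a assume Y: "Y \<in> commutant Rset"
  have k: "app Y (scale [:t:] v) = scale [:t:] (app Y v)" for t v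
  proof -
    have "kc t * Y = Y * kc t"
      using commutantD[OF Y] by (auto simp: Rset_def)
    then show ?thesis by (metis app_ring(6) app_sc)
  qed
  have "map_poly (app Y) (right_poly c a) = right_poly c (app Y a)"
  proof (rule poly_eq_by_values)
    fix s
    have "R c s * Y = Y * R c s"
      using commutantD[OF Y] by (auto simp: Rset_def)
    then have "app (R c s) (app Y a) = app Y (app (R c s) a)"
      by (metis app_ring(6))
    then show "peval [:s:] (map_poly (app Y) (right_poly c a)) = peval [:s:] (right_poly c (app Y a))"
      by (subst peval_map) (simp_all add: app_add k app_R_eq)
  qed
  then show "app (Y * Rm c m) a = app (Rm c m * Y) a"
    by (simp add: app_Rm flip: coeff_map_poly)
qed

text \<open>
  By left symmetry the derivation \<open>[L\<^sub>a(s), -]\<close> sends generators of \<open>calR\<close> into \<open>calR\<close>.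
\<close>

lemma bracket_L_calR: "X \<in> calR \<Longrightarrow> bracket (L a s) X \<in> calR"
  unfolding calR_def
proof (rule bracket_bicommutant)
  fix Y assume "Y \<in> Rset"
  then consider c t where "Y = R c t" | c where "Y = kc c"
    by (auto simp: Rset_def)
  then show "bracket (L a s) Y \<in> commutant (commutant Rset)"
  proof cases
    case 1
    show ?thesis
      unfolding 1 bracket_L_R[OF novikov] calR_def[symmetric]
      by (intro calR_diff calR_mult R_in_calR)
  next
    case 2
    then show ?thesis
      by (simp add: bracket_def L_sc commutant_zero)
  qed
qed

lemma bracket_del_R: "bracket del (R c s) = - (kc s * R c s)"
proof -
  have "sc [:s, 1:] = kc s + del"
    by (simp flip: sc_add)
  then show ?thesis
    by (simp add: bracket_def R_sc pcompose_pCons algebra_simps)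
qed

lemma bracket_del_calR: "X \<in> calR \<Longrightarrow> bracket del X \<in> calR"
  unfolding calR_def
proof (rule bracket_bicommutant)
  fix Y assume "Y \<in> Rset"
  then consider c t where "Y = R c t" | c where "Y = kc c"
    by (auto simp: Rset_def)
  then show "bracket del Y \<in> commutant (commutant Rset)"
  proof cases
    case 1
    have "0 - kc t * R c t \<in> calR"
      by (intro calR_diff calR_mult calR_0 R_in_calR kc_in_calR)
    then show ?thesis
      by (simp add: 1 bracket_del_R calR_def)
  next
    case 2
    then show ?thesis
      by (simp add: bracket_def sc_commute commutant_zero)
  qed
qed

text \<open>
  Operators of weight \<open>s\<close> are semilinear for the shift \<open>\<partial> \<mapsto> \<partial> + s\<close>.  Their kernels are \<open>H\<close>-submodules.
\<close>

definition weight :: "'k \<Rightarrow> 'v endo \<Rightarrow> bool" where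
  "weight s X \<longleftrightarrow> (\<forall>h. X * sc h = sc (pcompose h [:s, 1:]) * X)"

lemma weight_R: "weight s (R c s)" and weight_L: "weight s (L a s)"
  by (simp_all add: weight_def R_sc L_sc)

lemma weight_mult: "weight s X \<Longrightarrow> weight t Y \<Longrightarrow> weight (s + t) (X * Y)"
proof -
  assume X: "weight s X" and Y: "weight t Y"
  have "pcompose [:t, 1:] [:s, 1:] = [:s + t, 1:]"
    by (simp add: pcompose_pCons add.commute)
  moreover have "X * Y * sc h = sc (pcompose h (pcompose [:t, 1:] [:s, 1:])) * (X * Y)" for h
  proof -
    have "X * Y * sc h = X * sc (pcompose h [:t, 1:]) * Y"
      using Y by (simp add: weight_def mult.assoc)
    also have "\<dots> = sc (pcompose (pcompose h [:t, 1:]) [:s, 1:]) * (X * Y)"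
      using X by (simp add: weight_def mult.assoc)
    finally show ?thesis
      by (simp add: pcompose_assoc)
  qed
  ultimately show ?thesis
    by (simp add: weight_def)
qed

lemma weight_diff: "weight s X \<Longrightarrow> weight s Y \<Longrightarrow> weight s (X - Y)"
  and weight_add: "weight s X \<Longrightarrow> weight s Y \<Longrightarrow> weight s (X + Y)"
  by (simp_all only: weight_def left_diff_distrib right_diff_distrib distrib_left distrib_right) simp_all

lemma weight_bracket: "weight s X \<Longrightarrow> weight t Y \<Longrightarrow> weight (s + t) (bracket X Y)"
  unfolding bracket_def
  using weight_mult[of s X t Y] weight_mult[of t Y s X] by (simp add: add.commute weight_diff)

lemma weight_sc: "weight 0 (sc h)"
  by (simp add: weight_def sc_commute)

lemma weight_0_iff:
  assumes "X \<in> calR"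
  shows "weight 0 X \<longleftrightarrow> bracket del X = 0"
proof
  assume "bracket del X = 0"
  then have *: "X * del = del * X"
    by (simp add: bracket_def)
  have "X * sc h = sc h * X" for h
  proof (induction h)
    case (pCons c h)
    have e: "sc (pCons c h) = kc c + del * sc h"
      by (simp flip: sc_mult sc_add)
    have "X * (del * sc h) = del * (X * sc h)"
      by (simp add: * flip: mult.assoc)
    then have "X * (del * sc h) = del * sc h * X"
      by (simp add: pCons.IH mult.assoc)
    then show ?case
      unfolding e by (simp add: algebra_simps calR_kc[OF assms])
  qed simp
  then show "weight 0 X"
    by (simp add: weight_def)
next
  assume "weight 0 X"
  then have "X * del = del * X"
    by (metis weight_def pcompose_idR)
  then show "bracket del X = 0"
    by (simp add: bracket_def)
qed

lemma weight_app: "weight s X \<Longrightarrow> app X (scale h v) = scale (pcompose h [:s, 1:]) (app X v)"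
  by (metis weight_def app_ring(6) app_sc)

lemma right_poly_del:
  "right_poly c (scale [:0, 1:] a) = map_poly (scale [:0, 1:]) (right_poly c a) + pCons 0 (right_poly c a)"
  by (rule poly_eq_by_values)
    (simp add: peval_add weight_app[OF weight_R] pcompose_pCons flip: app_R_eq scale_left_distrib)

lemma Rm_Suc_del: "app (Rm c (Suc m)) (scale [:0, 1:] a) = scale [:0, 1:] (app (Rm c (Suc m)) a) + app (Rm c m) a"
  and Rm_0_del: "app (Rm c 0) (scale [:0, 1:] a) = scale [:0, 1:] (app (Rm c 0) a)"
  by (simp_all add: app_Rm right_poly_del coeff_map_poly)

text \<open>
  Coefficients of \<open>[\<partial>, R\<^sub>c(\<lambda>)] = -\<lambda> R\<^sub>c(\<lambda>)\<close>.
\<close>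

lemma bracket_del_Rm_Suc: "bracket del (Rm c (Suc m)) = - Rm c m"
  and bracket_del_Rm_0: "bracket del (Rm c 0) = 0"
  by (rule endo_eqI; simp add: bracket_def Rm_Suc_del Rm_0_del)+

lemma Rm_k_scale: "Rm (scale [:t:] c) m = kc t * Rm c m"
proof (rule endo_eqI)
  fix a
  have "right_poly (scale [:t:] c) a = map_poly (scale [:t:]) (right_poly c a)"
    by (rule poly_eq_by_values) (simp add: R_scale flip: app_R_eq)
  then show "app (Rm (scale [:t:] c) m) a = app (kc t * Rm c m) a"
    by (simp add: app_Rm coeff_map_poly)
qed

text \<open>
  Coefficients of \<open>b \<circ>\<^bsub>(\<lambda>)\<^esub> a\<close> are recovered from the values \<open>L\<^sub>b(s)a\<close>; those of \<open>a \<circ>\<^bsub>(\<lambda>)\<^esub> b\<close> are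
  recovered from the values \<open>R\<^sub>b(s)a\<close> by substituting \<open>-\<partial>-\<lambda>\<close> back.
\<close>

lemma ideal_of_UNIV_I:
  assumes "subspace I" "\<And>a c s. a \<in> I \<Longrightarrow> app (R c s) a \<in> I" "\<And>a c s. a \<in> I \<Longrightarrow> app (L c s) a \<in> I"
  shows "ideal_of UNIV I"
proof -
  note k = subspace_imp_k_subspace[OF assms(1)]
  have "coeff (lprod b a) n \<in> I" if "a \<in> I" for a b n
    by (rule coeff_in_k_subspace[OF k]) (use assms(3)[OF that] in \<open>simp add: app_L_peval\<close>)
  moreover have "coeff (lprod a b) n \<in> I" if "a \<in> I" for a b n
  proof (rule coeff_in_k_subspace[OF k])
    fix s
    have "coeff (right_poly b a) n \<in> I" for n
      by (rule coeff_in_k_subspace[OF k]) (use assms(2)[OF that] in \<open>simp add: app_R_eq\<close>)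
    then have "peval [:- s, - 1:] (right_poly b a) \<in> I"
      using assms(1) by (simp add: peval_def subspace_sum subspace_scale)
    then show "peval [:s:] (lprod a b) \<in> I"
      by (simp flip: app_L_peval app_L_eq)
  qed
  ultimately show ?thesis
    using assms(1) by (simp add: ideal_of_def)
qed

end

section \<open>Rank of submodules\<close>

context conformal_algebra
begin

text \<open>
  Elimination without division: the generator \<open>b\<close> is removed with the help of a pivot \<open>q\<^sub>j \<noteq> 0\<close>.
\<close>

lemma family_dependent:
  assumes "finite B" "finite A" "card B < card A" "\<And>i. i \<in> A \<Longrightarrow> f i \<in> span B"
  shows "\<exists>h. (\<exists>i\<in>A. h i \<noteq> 0) \<and> (\<Sum>i\<in>A. scale (h i) (f i)) = 0"
  using assms
proof (induction B arbitrary: A f rule: finite_induct)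
  case empty
  then obtain i where "i \<in> A" by fastforce
  then show ?case
    using empty(3) by (intro exI[of _ "\<lambda>_. 1"]) auto
next
  case (insert b B)
  have "\<forall>i\<in>A. \<exists>q. f i - scale q b \<in> span B"
    using insert.prems(3) span_breakdown_eq by blast
  then obtain q where q: "\<And>i. i \<in> A \<Longrightarrow> f i - scale (q i) b \<in> span B"
    by metis
  show ?case
  proof (cases "\<forall>i\<in>A. q i = 0")
    case True
    then show ?thesis
      using q insert.prems insert.hyps by (intro insert.IH) auto
  next
    case False
    then obtain j where j: "j \<in> A" "q j \<noteq> 0" by blast
    define g where "g i = scale (q j) (f i) - scale (q i) (f j)" for i
    have "g i \<in> span B" if "i \<in> A" for i
    proof -
      have "g i = scale (q j) (f i - scale (q i) b) - scale (q i) (f j - scale (q j) b)"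
        by (simp add: g_def scale_right_diff_distrib mult.commute)
      then show ?thesis
        using q that j by (simp add: span_diff span_scale)
    qed
    moreover have "card B < card (A - {j})"
      using insert.prems insert.hyps j by simp
    ultimately obtain h where h: "\<exists>i\<in>A - {j}. h i \<noteq> 0" "(\<Sum>i\<in>A - {j}. scale (h i) (g i)) = 0"
      using insert.IH[of "A - {j}" g] insert.prems(1) by blast
    define h' where "h' i = (if i = j then - (\<Sum>i\<in>A - {j}. h i * q i) else h i * q j)" for i
    have "(\<Sum>i\<in>A. scale (h' i) (f i)) = scale (h' j) (f j) + (\<Sum>i\<in>A - {j}. scale (h' i) (f i))"
      using insert.prems(1) j by (simp add: sum.remove)
    also have "\<dots> = (\<Sum>i\<in>A - {j}. scale (h i) (g i))"
      by (simp add: h'_def g_def scale_sum_left scale_right_diff_distrib sum_subtractf)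
    finally have "(\<Sum>i\<in>A. scale (h' i) (f i)) = 0"
      using h by simp
    moreover have "\<exists>i\<in>A. h' i \<noteq> 0"
      using h(1) j by (auto simp: h'_def)
    ultimately show ?thesis by blast
  qed
qed

lemma independent_card_le:
  assumes "finite B" "span B = UNIV" "independent S" "finite S"
  shows "card S \<le> card B"
proof (rule ccontr)
  assume "\<not> card S \<le> card B"
  then obtain h where "\<exists>i\<in>S. h i \<noteq> 0" "(\<Sum>i\<in>S. scale (h i) i) = 0"
    using family_dependent[of B S "\<lambda>x. x"] assms by auto
  then show False
    using assms(3,4) by (auto simp: dependent_explicit)
qed

text \<open>
  The maximum is attained if the algebra is finite.
\<close>

definition rank_of :: "'v set \<Rightarrow> nat" where
  "rank_of Y = Max (card ` {S. S \<subseteq> Y \<and> finite S \<and> independent S})"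

context
  assumes fin: finite_conformal
begin

lemma rank_of_finite: "finite (card ` {S. S \<subseteq> Y \<and> finite S \<and> independent S})"
proof -
  obtain B where "finite B" "span B = UNIV"
    using fin by (auto simp: finite_conformal_def)
  then have "card ` {S. S \<subseteq> Y \<and> finite S \<and> independent S} \<subseteq> {..card B}"
    by (auto intro: independent_card_le)
  then show ?thesis
    by (rule finite_subset) simp
qed

lemma rank_of_ge: "S \<subseteq> Y \<Longrightarrow> finite S \<Longrightarrow> independent S \<Longrightarrow> card S \<le> rank_of Y"
  unfolding rank_of_def by (rule Max_ge[OF rank_of_finite]) auto

lemma rank_of_attained: "\<exists>S. S \<subseteq> Y \<and> finite S \<and> independent S \<and> card S = rank_of Y"
proof -
  have "rank_of Y \<in> card ` {S. S \<subseteq> Y \<and> finite S \<and> independent S}"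
    unfolding rank_of_def using independent_empty by (intro Max_in rank_of_finite) blast
  then show ?thesis by auto
qed

end

end

section \<open>Semisimple algebras have no nilpotent right multiplications\<close>

context novikov_algebra
begin

text \<open>
  From \<open>R\<^sub>c(\<lambda>) h(\<partial>) = h(\<partial>+\<lambda>) R\<^sub>c(\<lambda>)\<close>: in the highest power of \<open>\<lambda>\<close> only the leading terms of \<open>h\<close> and of
  \<open>R\<^sub>c(\<lambda>)v\<close> meet.
\<close>

lemma Rm_scale_top:
  assumes "\<And>j. j > e \<Longrightarrow> app (Rm c j) v = 0" "degree h \<le> d"
  shows "app (Rm c (e + d)) (scale h v) = scale [:coeff h d:] (app (Rm c e) v)"
  using assms
proof (induction d arbitrary: e h)
  case 0
  then have "h = [:coeff h 0:]"
    by (simp add: degree_0_id)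
  then show ?case
    by (metis Nat.add_0_right Rm_in_calR calR_scale)
next
  case (Suc d)
  obtain a g where h: "h = pCons a g"
    by (rule pCons_cases)
  then have g: "degree g \<le> d"
    using Suc.prems(2) by (cases "g = 0") auto
  have "app (Rm c (e + Suc d)) (scale h v)
      = scale [:0, 1:] (app (Rm c (Suc e + d)) (scale g v)) + app (Rm c (e + d)) (scale g v)"
    unfolding h scale_pCons[of a g] using Suc.prems(1)[of "Suc (e + d)"]
    by (simp add: app_add calR_scale[OF Rm_in_calR] Rm_Suc_del del: scale_scale)
  also have "\<dots> = scale [:coeff g d:] (app (Rm c e) v)"
    using Suc.prems(1) g by (simp only: Suc.IH) simp
  finally show ?case
    by (simp add: h)
qed

lemma Rm_eq_0_iff: "(\<forall>m. app (Rm c m) v = 0) \<longleftrightarrow> lprod v c = 0"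
proof -
  have "(\<forall>m. app (Rm c m) v = 0) \<longleftrightarrow> right_poly c v = 0"
    by (auto simp: app_Rm poly_eq_iff)
  also have "\<dots> \<longleftrightarrow> (\<forall>s. app (R c s) v = 0)"
    by (auto simp: app_R_eq intro: poly_eq_by_values)
  finally show ?thesis
    by (simp add: R_eq_0_iff)
qed

lemma Rm_eventually_0: "\<exists>d. \<forall>j>d. app (Rm c j) v = 0"
  by (metis app_Rm coeff_eq_0)

lemma Rm_top_nonzero:
  assumes "lprod v c \<noteq> 0"
  shows "\<exists>e. app (Rm c e) v \<noteq> 0 \<and> (\<forall>j>e. app (Rm c j) v = 0)"
proof (intro exI conjI allI impI)
  have "right_poly c v \<noteq> 0"
    using assms Rm_eq_0_iff[of c v] by (auto simp: app_Rm)
  then show "app (Rm c (degree (right_poly c v))) v \<noteq> 0"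
    "\<And>j. j > degree (right_poly c v) \<Longrightarrow> app (Rm c j) v = 0"
    by (auto simp: app_Rm coeff_eq_0)
qed

lemma bracket_power:
  assumes "X \<in> calR" "bracket l X \<in> calR"
  shows "bracket l (X ^ Suc n) = kc (of_nat (Suc n)) * X ^ n * bracket l X"
proof (induction n)
  case (Suc n)
  have c: "bracket l X * X ^ Suc n = X ^ Suc n * bracket l X"
    using assms by (intro calR_commute calR_power)
  have "bracket l (X ^ Suc (Suc n)) = bracket l X * X ^ Suc n + X * (kc (of_nat (Suc n)) * X ^ n * bracket l X)"
    by (simp only: power_Suc[of X "Suc n"] bracket_mult Suc.IH)
  also have "\<dots> = X ^ Suc n * bracket l X + kc (of_nat (Suc n)) * (X ^ Suc n * bracket l X)"
  proof -
    have "X * (kc (of_nat (Suc n)) * X ^ n * bracket l X) = X * kc (of_nat (Suc n)) * X ^ n * bracket l X"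
      by (simp only: mult.assoc)
    then show ?thesis
      unfolding c calR_kc[OF assms(1)] by (simp only: mult.assoc power_Suc)
  qed
  also have "\<dots> = kc (of_nat (Suc (Suc n))) * X ^ Suc n * bracket l X"
    by (simp only: of_nat_Suc[of "Suc n"] kc_add kc_1 distrib_right mult_1_left mult.assoc)
  finally show ?case .
qed simp

lemma kc_cancel: "a \<noteq> 0 \<Longrightarrow> kc a * X = 0 \<Longrightarrow> X = 0"
proof -
  assume a: "a \<noteq> 0" "kc a * X = 0"
  have "X = kc (inverse a) * (kc a * X)"
    using a(1) by (simp flip: mult.assoc kc_mult)
  then show ?thesis
    using a(2) by simp
qed

text \<open>In characteristic zero derivations preserve nilpotency: \<open>X\<^sup>n = 0\<close> gives \<open>X\<^bsup>n-j\<^esup> (X')\<^bsup>2j\<^esup> = 0\<close> for all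
  \<open>j \<le> n\<close>, by differentiating and multiplying by \<open>X'\<close>.\<close>

lemma bracket_nilpotent:
  assumes X: "X \<in> calR" and l: "\<And>Z. Z \<in> calR \<Longrightarrow> bracket l Z \<in> calR" and n: "X ^ n = 0"
  shows "bracket l X ^ (2 * n) = 0"
proof -
  define Y where "Y = bracket l X"
  define Z where "Z = bracket l Y"
  note in_calR = X l[OF X, folded Y_def] l[OF l[OF X], folded Y_def, folded Z_def]
  have "j \<le> n \<Longrightarrow> X ^ (n - j) * Y ^ (2 * j) = 0" for j
  proof (induction j)
    case (Suc j)
    define m where "m = n - Suc j"
    have m: "n - j = Suc m"
      using Suc.prems by (simp add: m_def)
    have 0: "X ^ Suc m * Y ^ (2 * j) = 0"
      using Suc m by simp
    have dY: "bracket l (Y ^ (2 * j)) * Y = kc (of_nat (2 * j)) * Y ^ (2 * j) * Z"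
    proof (cases j)
      case (Suc i)
      have "bracket l (Y ^ Suc (Suc (2 * i))) * Y
          = kc (of_nat (Suc (Suc (2 * i)))) * Y ^ Suc (2 * i) * (Z * Y)"
      proof -
        have "bracket l (Y ^ Suc (Suc (2 * i))) = kc (of_nat (Suc (Suc (2 * i)))) * Y ^ Suc (2 * i) * Z"
          unfolding Z_def by (rule bracket_power) (use in_calR in \<open>auto simp: Z_def\<close>)
        then show ?thesis by (simp only: mult.assoc)
      qed
      also have "Z * Y = Y * Z"
        using in_calR by (intro calR_commute)
      also have "kc (of_nat (Suc (Suc (2 * i)))) * Y ^ Suc (2 * i) * (Y * Z)
          = kc (of_nat (Suc (Suc (2 * i)))) * Y ^ Suc (Suc (2 * i)) * Z"
        by (simp only: power_Suc2[of Y "Suc (2 * i)"] mult.assoc)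
      also have "Suc (Suc (2 * i)) = 2 * j"
        using Suc by simp
      finally show ?thesis .
    qed (simp add: bracket_def)
    have "0 = bracket l (X ^ Suc m * Y ^ (2 * j)) * Y"
      using 0 by (simp add: bracket_def)
    also have "\<dots> = bracket l (X ^ Suc m) * Y ^ (2 * j) * Y + X ^ Suc m * (bracket l (Y ^ (2 * j)) * Y)"
      by (simp add: bracket_mult distrib_right distrib_left mult.assoc)
    also have "X ^ Suc m * (bracket l (Y ^ (2 * j)) * Y) = kc (of_nat (2 * j)) * (X ^ Suc m * Y ^ (2 * j)) * Z"
    proof -
      have "X ^ Suc m * (kc (of_nat (2 * j)) * Y ^ (2 * j) * Z) = X ^ Suc m * kc (of_nat (2 * j)) * Y ^ (2 * j) * Z"
        by (simp only: mult.assoc)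
      then show ?thesis
        unfolding dY calR_kc[OF calR_power[OF X]] by (simp only: mult.assoc)
    qed
    also have "bracket l (X ^ Suc m) * Y ^ (2 * j) * Y
        = kc (of_nat (Suc m)) * (X ^ m * Y ^ (2 * Suc j))"
    proof -
      have "Y ^ (2 * Suc j) = Y * Y ^ (2 * j) * Y"
        by (simp add: power_commutes mult.assoc)
      moreover have "bracket l (X ^ Suc m) = kc (of_nat (Suc m)) * X ^ m * Y"
        unfolding Y_def by (rule bracket_power) (use in_calR in \<open>auto simp: Y_def\<close>)
      ultimately show ?thesis
        by (simp only: mult.assoc)
    qed
    finally have "kc (of_nat (Suc m)) * (X ^ m * Y ^ (2 * Suc j)) = 0"
      using 0 by simp
    then have "X ^ m * Y ^ (2 * Suc j) = 0"
      by (rule kc_cancel[rotated]) (simp del: of_nat_Suc)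
    then show ?case
      by (simp add: m_def)
  qed (simp add: n)
  from this[of n] show ?thesis
    by (simp add: Y_def)
qed

lemma module_k: "module (\<lambda>r. scale [:r:])"
  by unfold_locales (simp_all add: scale_right_distrib mult.commute flip: scale_left_distrib one_pCons)

end

locale semisimple_novikov_algebra = novikov_algebra scale lprod
  for scale :: "'k::field_char_0 poly \<Rightarrow> 'v::ab_group_add \<Rightarrow> 'v"
    and lprod :: "'v \<Rightarrow> 'v \<Rightarrow> 'v poly" +
  assumes finite_conformal: finite_conformal
    and semisimple: semisimple
begin

lemma square_zero_ideal:
  assumes I: "ideal_of UNIV I" and sq: "\<And>a b. a \<in> I \<Longrightarrow> b \<in> I \<Longrightarrow> lprod a b = 0"
  shows "I = {0}"
proof -
  interpret k: module "\<lambda>r. scale [:r:]"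
    by (rule module_k)
  have "{coeff (lprod a b) m |a b m. a \<in> I \<and> b \<in> I} \<subseteq> {0}"
    using sq by auto
  then have "k.span {coeff (lprod a b) m |a b m. a \<in> I \<and> b \<in> I} \<subseteq> {0}"
    by (rule k.span_minimal) (simp add: k.subspace_def)
  then have "derived I (Suc 0) = {0}"
    using k.span_zero by auto
  then show ?thesis
    using I semisimple unfolding semisimple_def solvable_def by blast
qed

lemma ideal_subspace: "ideal_of UNIV I \<Longrightarrow> subspace I"
  by (simp add: ideal_of_def)

text \<open>
  The torsion elements form an ideal, and \<open>hv = 0\<close> kills the top coefficient of every \<open>R\<^sub>b(\<lambda>)v\<close>.
\<close>

lemma torsion_free:
  assumes "scale h v = 0" "h \<noteq> 0"
  shows "v = 0"
proof -
  let ?T = "{v. \<exists>h. h \<noteq> 0 \<and> scale h v = 0}"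
  have shift: "pcompose h [:s, 1:] \<noteq> 0" if "h \<noteq> 0" for h :: "'k poly" and s
    using that by (subst pcompose_eq_0_iff) auto
  have "?T = {0}"
  proof (rule square_zero_ideal)
    show "ideal_of UNIV ?T"
    proof (rule ideal_of_UNIV_I)
      show "subspace ?T"
        unfolding subspace_def
      proof (intro conjI ballI allI)
        show "0 \<in> ?T" by (auto intro: exI[of _ 1])
      next
        fix x y assume "x \<in> ?T" "y \<in> ?T"
        then obtain g h where "g \<noteq> 0" "scale g x = 0" "h \<noteq> 0" "scale h y = 0" by blast
        moreover have "scale (g * h) (x + y) = scale h (scale g x) + scale g (scale h y)"
          by (simp add: scale_right_distrib mult.commute)
        ultimately show "x + y \<in> ?T"
          by (intro CollectI exI[of _ "g * h"]) simp
      next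
        fix c x assume "x \<in> ?T"
        then obtain g where "g \<noteq> 0" "scale g x = 0" by blast
        moreover have "scale g (scale c x) = scale c (scale g x)"
          by (simp add: mult.commute)
        ultimately show "scale c x \<in> ?T"
          by (intro CollectI exI[of _ g]) simp
      qed
    next
      fix a c s assume "a \<in> ?T"
      then obtain h where h: "h \<noteq> 0" "scale h a = 0" by blast
      show "app (R c s) a \<in> ?T"
        using weight_app[OF weight_R, of c s h a] h shift[of h s] by auto
      show "app (L c s) a \<in> ?T"
        using weight_app[OF weight_L, of c s h a] h shift[of h s] by auto
    qed
  next
    fix v b assume "v \<in> ?T"
    then obtain h where h: "h \<noteq> 0" "scale h v = 0" by blast
    show "lprod v b = 0"
    proof (rule ccontr)
      assume "lprod v b \<noteq> 0"
      then obtain e where e: "app (Rm b e) v \<noteq> 0" "\<And>j. j > e \<Longrightarrow> app (Rm b j) v = 0"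
        using Rm_top_nonzero by blast
      have "scale [:lead_coeff h:] (app (Rm b e) v) = 0"
        using Rm_scale_top[OF e(2), where h = h and d = "degree h"] h by simp
      then have "scale [:inverse (lead_coeff h):] (scale [:lead_coeff h:] (app (Rm b e) v)) = 0"
        by simp
      then show False
        using e(1) h(1) by (simp flip: one_pCons)
    qed
  qed
  then show ?thesis
    using assms by blast
qed

text \<open>
  The formula for \<open>[L, R]\<close> shows that the vectors killed by all right multiplications form an ideal.
\<close>

lemma left_annihilator:
  assumes "\<And>c. lprod a c = 0"
  shows "a = 0"
proof -
  let ?A = "{a. \<forall>c s. app (R c s) a = 0}"
  have "?A = {0}"
  proof (rule square_zero_ideal)
    show "ideal_of UNIV ?A"
    proof (rule ideal_of_UNIV_I)
      show "subspace ?A"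
        by (auto simp: subspace_def app_add weight_app[OF weight_R])
    next
      fix a c s assume a: "a \<in> ?A"
      then show "app (R c s) a \<in> ?A"
        by simp
      show "app (L c s) a \<in> ?A"
      proof (standard, intro allI)
        fix d t
        have "app (bracket (L c s) (R d t)) a = 0"
          using a by (simp add: bracket_L_R[OF novikov])
        then show "app (R d t) (app (L c s) a) = 0"
          using a by (simp add: bracket_def)
      qed
    qed
  qed (use R_eq_0_iff in blast)
  then show ?thesis
    using assms R_eq_0_iff by blast
qed

text \<open>
  Only operators with a weight are admitted, so that kernels are \<open>H\<close>-submodules.
\<close>

definition Nil :: "'v endo set" where
  "Nil = {X \<in> calR. (\<exists>s. weight s X) \<and> (\<exists>n. X ^ n = 0)}"

lemma Nil_D: "X \<in> Nil \<Longrightarrow> X \<in> calR"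
  by (simp add: Nil_def)

lemma bracket_L_Nil: "X \<in> Nil \<Longrightarrow> bracket (L a s) X \<in> Nil"
proof -
  assume X: "X \<in> Nil"
  then obtain t n where t: "weight t X" "X ^ n = 0"
    by (auto simp: Nil_def)
  show ?thesis
    unfolding Nil_def
    using bracket_L_calR[OF Nil_D[OF X]] weight_bracket[OF weight_L t(1)]
      bracket_nilpotent[OF Nil_D[OF X] bracket_L_calR t(2)]
    by blast
qed

text \<open>
  A relation of \<open>y\<close> with elements of \<open>Y'\<close> would give \<open>h(\<partial>+s) X y = 0\<close>.
\<close>

lemma rank_of_kernel_less:
  assumes "Y' \<subseteq> Y" "weight s X" "\<And>y. y \<in> Y' \<Longrightarrow> app X y = 0" "y \<in> Y" "app X y \<noteq> 0"
  shows "rank_of Y' < rank_of Y"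
proof -
  obtain S where S: "S \<subseteq> Y'" "finite S" "independent S" "card S = rank_of Y'"
    using rank_of_attained[OF finite_conformal] by blast
  have y: "y \<notin> S"
    using S assms by blast
  have "independent (insert y S)"
    unfolding dependent_explicit
  proof safe
    fix t u v assume t: "finite t" "t \<subseteq> insert y S" "(\<Sum>v\<in>t. scale (u v) v) = 0" "v \<in> t" "u v \<noteq> 0"
    have uy: "u y = 0" if "y \<in> t"
    proof -
      have "0 = app X (\<Sum>v\<in>t. scale (u v) v)"
        using t by simp
      also have "\<dots> = (\<Sum>v\<in>t. scale (pcompose (u v) [:s, 1:]) (app X v))"
        by (simp add: app_sum weight_app[OF assms(2)])
      also have "\<dots> = (\<Sum>v\<in>{y}. scale (pcompose (u v) [:s, 1:]) (app X v))"
        using t that S(1) assms(3) by (intro sum.mono_neutral_right) auto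
      finally have "pcompose (u y) [:s, 1:] = 0"
        using torsion_free[of "pcompose (u y) [:s, 1:]" "app X y"] assms(5) by auto
      then show ?thesis
        by (subst (asm) pcompose_eq_0_iff) auto
    qed
    have "(\<Sum>v\<in>t - {y}. scale (u v) v) = (\<Sum>v\<in>t. scale (u v) v)"
      using t(1) uy by (intro sum.mono_neutral_left) auto
    moreover have "v \<in> t - {y}"
      using t uy by auto
    moreover have "finite (t - {y})" "t - {y} \<subseteq> S"
      using t by auto
    ultimately have "dependent S"
      unfolding dependent_explicit using t
      by (intro exI[of _ "t - {y}"] exI[of _ u] conjI bexI[of _ v]) simp_all
    then show False
      using S(3) by simp
  qed
  then have "card (insert y S) \<le> rank_of Y"
    using S assms by (intro rank_of_ge[OF finite_conformal]) auto
  then show ?thesis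
    using S y by simp
qed

text \<open>
  In a stable nonzero submodule of least rank every \<open>X \<in> Nil\<close> vanishes: its kernel there is
  again stable, and nonzero by nilpotency, so it cannot have smaller rank.
\<close>

lemma nil_kernel:
  assumes I: "subspace I" "I \<noteq> {0}" "\<And>X y. X \<in> Nil \<Longrightarrow> y \<in> I \<Longrightarrow> app X y \<in> I"
  shows "\<exists>y\<in>I. y \<noteq> 0 \<and> (\<forall>X\<in>Nil. app X y = 0)"
proof -
  define P where "P Y \<longleftrightarrow> subspace Y \<and> Y \<noteq> {0} \<and> Y \<subseteq> I \<and> (\<forall>X\<in>Nil. \<forall>y\<in>Y. app X y \<in> Y)" for Y
  have "P I"
    using I by (simp add: P_def)
  then obtain Y where Y: "P Y" "\<And>Y'. P Y' \<Longrightarrow> rank_of Y \<le> rank_of Y'"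
    using ex_has_least_nat[of P I rank_of] by blast
  obtain y where y: "y \<in> Y" "y \<noteq> 0"
    using Y(1) by (auto simp: P_def dest: subspace_0)
  have "app X y0 = 0" if X: "X \<in> Nil" and y0: "y0 \<in> Y" for X y0
  proof (rule ccontr)
    assume ne: "app X y0 \<noteq> 0"
    obtain s n where s: "weight s X" and n: "X ^ n = 0"
      using X by (auto simp: Nil_def)
    define Y' where "Y' = {y \<in> Y. app X y = 0}"
    have "subspace Y'"
      using Y(1) by (auto simp: P_def Y'_def subspace_def app_add weight_app[OF s])
    moreover have "Y' \<noteq> {0}"
    proof -
      define k where "k = (LEAST k. app (X ^ k) y = 0)"
      have k: "app (X ^ k) y = 0"
        unfolding k_def by (rule LeastI[of _ n]) (simp add: n)
      then obtain j where j: "k = Suc j"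
        using y by (cases k) auto
      have "app (X ^ j) y \<noteq> 0"
        using not_less_Least[of j "\<lambda>k. app (X ^ k) y = 0"] j by (simp add: k_def)
      moreover have "app (X ^ i) y \<in> Y" for i
        by (induction i) (use y Y(1) X in \<open>auto simp: P_def\<close>)
      ultimately show ?thesis
        using k unfolding Y'_def j by auto
    qed
    moreover have "app Z y \<in> Y'" if "Z \<in> Nil" "y \<in> Y'" for Z y
    proof -
      have "app X (app Z y) = app Z (app X y)"
        using calR_commute[OF Nil_D[OF X] Nil_D[OF that(1)]] by (metis app_ring(6))
      then show ?thesis
        using that Y(1) by (auto simp: Y'_def P_def)
    qed
    ultimately have "P Y'"
      using Y(1) by (auto simp: P_def Y'_def)
    moreover have "rank_of Y' < rank_of Y"
      by (rule rank_of_kernel_less[OF _ s _ y0 ne]) (auto simp: Y'_def)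
    ultimately show False
      using Y(2) by fastforce
  qed
  then show ?thesis
    using y Y(1) by (auto simp: P_def)
qed

definition image_ideal :: "'v endo set \<Rightarrow> 'v set" where
  "image_ideal A = span {app X v | X v. X \<in> A}"

lemma weight_zero_on_span:
  assumes "weight s X" "\<And>v. v \<in> G \<Longrightarrow> app X v = 0" "v \<in> span G"
  shows "app X v = 0"
  using assms(3) by (induction rule: span_induct_alt) (simp_all add: assms app_add weight_app[OF assms(1)])

lemma weight_span:
  assumes "weight s X" "\<And>v. v \<in> G \<Longrightarrow> app X v \<in> span G" "v \<in> span G"
  shows "app X v \<in> span G"
  using assms(3) by (induction rule: span_induct_alt)
    (simp_all add: assms app_add weight_app[OF assms(1)] span_add span_scale span_zero)

text \<open>
  \<open>R\<^sub>c(s)\<close> commutes with \<open>A\<close>, and \<open>L\<^sub>c(s) X = X L\<^sub>c(s) + [L\<^sub>c(s), X]\<close>.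
\<close>

lemma image_ideal_ideal:
  assumes A: "A \<subseteq> calR" "\<And>X a s. X \<in> A \<Longrightarrow> bracket (L a s) X \<in> A"
  shows "ideal_of UNIV (image_ideal A)"
proof (rule ideal_of_UNIV_I)
  show "subspace (image_ideal A)"
    by (simp add: image_ideal_def subspace_span)
next
  fix a c s assume a: "a \<in> image_ideal A"
  show "app (R c s) a \<in> image_ideal A"
    using a unfolding image_ideal_def
  proof (rule weight_span[OF weight_R, rotated])
    fix v assume "v \<in> {app X v | X v. X \<in> A}"
    then obtain X w where X: "X \<in> A" "v = app X w" by blast
    then have "app (R c s) v = app X (app (R c s) w)"
      using calR_commute[of X "R c s"] A(1) R_in_calR by (metis app_ring(6) subsetD)
    then show "app (R c s) v \<in> span {app X v | X v. X \<in> A}"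
      using X by (auto intro: span_base)
  qed
  show "app (L c s) a \<in> image_ideal A"
    using a unfolding image_ideal_def
  proof (rule weight_span[OF weight_L, rotated])
    fix v assume "v \<in> {app X v | X v. X \<in> A}"
    then obtain X w where X: "X \<in> A" "v = app X w" by blast
    then have "app (L c s) v = app X (app (L c s) w) + app (bracket (L c s) X) w"
      by (simp add: bracket_def)
    then show "app (L c s) v \<in> span {app X v | X v. X \<in> A}"
      using X(1) A(2)[OF X(1), of c s] by (simp only:) (intro span_add span_base; blast)
  qed
qed

text \<open>
  If \<open>c\<close> lies in the ideal \<open>K\<close> generated by the image of \<open>A\<close>, then \<open>R\<^sub>c(s) X w = X R\<^sub>c(s) w\<close> with
  \<open>R\<^sub>c(s) w \<in> K\<close>, and \<open>X\<close> kills \<open>K\<close>.  So \<open>K\<close> has zero multiplication.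
\<close>

lemma image_ideal_square_zero:
  assumes A: "A \<subseteq> calR" "\<And>X a s. X \<in> A \<Longrightarrow> bracket (L a s) X \<in> A"
    and wt: "\<And>X. X \<in> A \<Longrightarrow> \<exists>s. weight s X"
    and sq: "\<And>X Y. X \<in> A \<Longrightarrow> Y \<in> A \<Longrightarrow> X * Y = 0"
    and X: "X \<in> A"
  shows "X = 0"
proof -
  note id = image_ideal_ideal[OF A]
  have kill: "app X v = 0" if X: "X \<in> A" and v: "v \<in> image_ideal A" for X v
  proof -
    obtain s where s: "weight s X"
      using wt X by blast
    show ?thesis
      using v unfolding image_ideal_def
    proof (rule weight_zero_on_span[OF s, rotated])
      fix v assume "v \<in> {app X v | X v. X \<in> A}"
      then obtain Y w where "Y \<in> A" "v = app Y w" by blast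
      then show "app X v = 0"
        using sq[OF X \<open>Y \<in> A\<close>] by (metis app_ring(1,6))
    qed
  qed
  have "image_ideal A = {0}"
  proof (rule square_zero_ideal[OF id])
    fix a c assume a: "a \<in> image_ideal A" and c: "c \<in> image_ideal A"
    have "app (R c s) a = 0" for s
      using a unfolding image_ideal_def
    proof (rule weight_zero_on_span[OF weight_R, rotated])
      fix v assume "v \<in> {app X v | X v. X \<in> A}"
      then obtain X w where X: "X \<in> A" "v = app X w" by blast
      have "app (R c s) w \<in> image_ideal A"
        using id c by (auto simp: ideal_of_def app_R prod_at_def peval_def subspace_sum subspace_scale)
      moreover have "app (R c s) v = app X (app (R c s) w)"
        using X calR_commute[of X "R c s"] A(1) R_in_calR by (metis app_ring(6) subsetD)
      ultimately show "app (R c s) v = 0"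
        using kill X by simp
    qed
    then show "lprod a c = 0"
      using R_eq_0_iff by blast
  qed
  moreover have "app X v \<in> image_ideal A" for v
    unfolding image_ideal_def using X by (blast intro: span_base)
  ultimately show ?thesis
    by (auto intro: endo_eqI)
qed

text \<open>
  Let \<open>J\<close> be the common kernel of \<open>Nil\<close> and \<open>I\<close> the ideal generated by its image.  For \<open>a \<in> J\<close> and
  \<open>n \<in> Nil\<close> the operator \<open>[L\<^sub>a(s), n]\<close> equals \<open>L\<^sub>a(s) n\<close> and has its image in \<open>J\<close>, so it is annihilated by
  \<open>Nil\<close>.  Elements of \<open>Nil\<close> annihilated by \<open>Nil\<close> have products zero, hence vanish.  So \<open>J \<circ> I = 0\<close>, the
  ideal \<open>J \<inter> I\<close> is zero, and this contradicts the existence of a common kernel in \<open>I\<close>, unless \<open>I = 0\<close>.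
\<close>

theorem calR_reduced:
  assumes "X \<in> calR" "weight s X" "X ^ n = 0"
  shows "X = 0"
proof -
  define J where "J = {v. \<forall>X\<in>Nil. app X v = 0}"
  define I where "I = image_ideal Nil"
  define Z where "Z = {z \<in> Nil. \<forall>n\<in>Nil. n * z = 0}"
  have Z0: "z = 0" if "z \<in> Z" for z
  proof (rule image_ideal_square_zero[of Z, OF _ _ _ _ that])
    show "bracket (L a s) X \<in> Z" if X: "X \<in> Z" for X a s
    proof -
      have "n * bracket (L a s) X = 0" if n: "n \<in> Nil" for n
      proof -
        have "n * X = 0" "bracket (L a s) n * X = 0"
          using X n bracket_L_Nil by (auto simp: Z_def)
        then show ?thesis
          using bracket_mult[of "L a s" n X] by (simp add: bracket_def[of _ 0])
      qed
      then show ?thesis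
        using X bracket_L_Nil by (simp add: Z_def)
    qed
  qed (auto simp: Z_def Nil_def)
  have J: "ideal_of UNIV J"
  proof (rule ideal_of_UNIV_I)
    show "subspace J"
      unfolding J_def subspace_def
      by (auto simp: app_add) (auto simp: Nil_def weight_app)
  next
    fix a c s assume a: "a \<in> J"
    show "app (R c s) a \<in> J"
      unfolding J_def
    proof (standard, intro ballI)
      fix X assume X: "X \<in> Nil"
      have "app X (app (R c s) a) = app (R c s) (app X a)"
        using calR_commute[OF Nil_D[OF X] R_in_calR] by (metis app_ring(6))
      then show "app X (app (R c s) a) = 0"
        using a X by (simp add: J_def)
    qed
    show "app (L c s) a \<in> J"
      unfolding J_def
    proof (standard, intro ballI)
      fix X assume X: "X \<in> Nil"
      have "app (bracket (L c s) X) a = 0" "app X a = 0"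
        using a X bracket_L_Nil by (auto simp: J_def)
      then show "app X (app (L c s) a) = 0"
        by (simp add: bracket_def)
    qed
  qed
  have I: "ideal_of UNIV I"
    unfolding I_def by (rule image_ideal_ideal) (auto simp: Nil_D bracket_L_Nil)
  have JI: "lprod a c = 0" if a: "a \<in> J" and c: "c \<in> I" for a c
  proof (rule poly_eq_by_values)
    fix s
    have LJ: "app (L a s) b \<in> J" for b
      using J a by (auto simp: ideal_of_def app_L prod_at_def peval_def subspace_sum subspace_scale)
    have "app (L a s) c = 0"
      using c unfolding I_def image_ideal_def
    proof (rule weight_zero_on_span[OF weight_L, rotated])
      fix v assume "v \<in> {app X v | X v. X \<in> Nil}"
      then obtain X w where X: "X \<in> Nil" "v = app X w" by blast
      have e: "app (bracket (L a s) X) b = app (L a s) (app X b)" for b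
        using LJ[of b] X by (simp add: bracket_def J_def)
      have "n * bracket (L a s) X = 0" if "n \<in> Nil" for n
        by (rule endo_eqI) (use e LJ that in \<open>auto simp: J_def\<close>)
      then have "bracket (L a s) X = 0"
        using X bracket_L_Nil by (intro Z0) (simp add: Z_def)
      then show "app (L a s) v = 0"
        using e[of w] X by simp
    qed
    then show "peval [:s:] (lprod a c) = peval [:s:] 0"
      by (simp add: app_L_peval)
  qed
  have "ideal_of UNIV (J \<inter> I)"
    using I J by (auto simp: ideal_of_def subspace_inter)
  then have JI0: "J \<inter> I = {0}"
    by (rule square_zero_ideal) (use JI in blast)
  have "I = {0}"
  proof (rule ccontr)
    assume "I \<noteq> {0}"
    moreover have "app X y \<in> I" if "X \<in> Nil" for X y
      unfolding I_def image_ideal_def using that by (blast intro: span_base)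
    ultimately obtain y where "y \<in> I" "y \<noteq> 0" "\<forall>X\<in>Nil. app X y = 0"
      using nil_kernel[of I] ideal_subspace[OF I] by blast
    then have "y \<in> J \<inter> I"
      by (simp add: J_def)
    then show False
      using JI0 \<open>y \<noteq> 0\<close> by blast
  qed
  moreover have "app X v \<in> I" for v
    unfolding I_def image_ideal_def using assms by (auto intro!: span_base simp: Nil_def)
  ultimately show ?thesis
    by (auto intro: endo_eqI)
qed

end

section \<open>Polynomials in an operator\<close>

context novikov_algebra
begin

definition opoly :: "'k poly \<Rightarrow> 'v endo \<Rightarrow> 'v endo" where
  "opoly p T = (\<Sum>n\<le>degree p. kc (coeff p n) * T ^ n)"

lemma opoly_bound:
  assumes "degree p \<le> N"
  shows "opoly p T = (\<Sum>n\<le>N. kc (coeff p n) * T ^ n)"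
  unfolding opoly_def
  by (rule sum.mono_neutral_left) (use assms in \<open>auto simp: coeff_eq_0\<close>)

lemma opoly_0 [simp]: "opoly 0 T = 0"
  by (simp add: opoly_def)

lemma opoly_pCons:
  assumes "T \<in> calR"
  shows "opoly (pCons a p) T = kc a + T * opoly p T"
proof -
  have "opoly (pCons a p) T = (\<Sum>n\<le>Suc (degree p). kc (coeff (pCons a p) n) * T ^ n)"
    by (rule opoly_bound) (rule degree_pCons_le)
  also have "\<dots> = kc a + (\<Sum>n\<le>degree p. kc (coeff p n) * T ^ Suc n)"
    by (subst sum.atMost_Suc_shift) simp
  also have "(\<Sum>n\<le>degree p. kc (coeff p n) * T ^ Suc n) = T * opoly p T"
    unfolding opoly_def sum_distrib_left
    by (rule sum.cong) (simp_all add: calR_kc[OF assms] flip: mult.assoc)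
  finally show ?thesis .
qed

lemma opoly_const [simp]: "opoly [:a:] T = kc a"
  by (simp add: opoly_def)

lemma opoly_add: "opoly (p + q) T = opoly p T + opoly q T"
proof -
  let ?N = "max (degree p) (degree q)"
  have "degree (p + q) \<le> ?N"
    by (rule degree_add_le) auto
  then show ?thesis
    by (simp add: opoly_bound[of _ ?N] sum.distrib kc_add distrib_right)
qed

lemma opoly_smult: "opoly (smult a p) T = kc a * opoly p T"
  unfolding opoly_bound[OF degree_smult_le]
  by (simp add: opoly_def sum_distrib_left mult.assoc kc_mult del: sc_mult)

lemma opoly_mult:
  assumes "T \<in> calR"
  shows "opoly (p * q) T = opoly p T * opoly q T"
  by (induction p)
    (simp_all add: opoly_add opoly_smult opoly_pCons[OF assms] distrib_right mult.assoc)

lemma opoly_power: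
  assumes "T \<in> calR"
  shows "opoly (p ^ n) T = opoly p T ^ n"
  by (induction n) (simp_all add: opoly_mult[OF assms] one_pCons)

lemma opoly_calR:
  assumes "T \<in> calR"
  shows "opoly p T \<in> calR"
  by (induction p)
    (simp_all add: opoly_pCons[OF assms] calR_0 calR_add calR_mult assms kc_in_calR)

lemma opoly_weight_0:
  assumes "T \<in> calR" "weight 0 T"
  shows "weight 0 (opoly p T)"
proof (induction p)
  case 0
  show ?case using weight_sc[of 0] by simp
next
  case (pCons a p)
  then show ?case
    using weight_mult[OF assms(2) pCons.IH] by (simp add: opoly_pCons[OF assms(1)] weight_add weight_sc)
qed

lemma opoly_eigen:
  assumes "T \<in> calR" "T * Y = kc a * Y"
  shows "opoly p T * Y = kc (poly p a) * Y"
proof (induction p)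
  case (pCons b p)
  have "opoly (pCons b p) T * Y = kc b * Y + T * (opoly p T * Y)"
    by (simp add: opoly_pCons[OF assms(1)] distrib_right mult.assoc)
  also have "T * (opoly p T * Y) = T * kc (poly p a) * Y"
    by (simp add: pCons.IH mult.assoc)
  also have "\<dots> = kc (poly p a) * (kc a * Y)"
    by (simp only: calR_kc[OF assms(1)] mult.assoc assms(2))
  finally show ?case
    by (simp only: poly_pCons kc_add kc_mult distrib_right mult.assoc mult.commute[of a])
qed simp

lemma opoly_eigenvector:
  assumes "T \<in> calR" "app T u = scale [:a:] u"
  shows "app (opoly p T) u = scale [:poly p a:] u"
proof (induction p)
  case (pCons b p)
  then show ?case
    by (simp add: opoly_pCons[OF assms(1)] calR_scale[OF assms(1)] assms(2) mult.commute
        flip: scale_left_distrib)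
qed simp

end

section \<open>Operators of weight zero are algebraic\<close>

context semisimple_novikov_algebra
begin

text \<open>
  If \<open>h\<^sub>0(\<partial>) w + h\<^sub>1(\<partial>) T w + \<dots> = 0\<close>, then applying the highest coefficients of \<open>R\<^sub>c(\<lambda>)\<close> isolates the
  terms of top degree in \<open>\<partial>\<close>.
\<close>

lemma leading_relation:
  assumes T: "T \<in> calR" and d: "\<And>i. i \<le> N \<Longrightarrow> degree (h i) \<le> d"
    and rel: "(\<Sum>i\<le>N. scale (h i) (app (T ^ i) w)) = 0"
    and e: "\<And>j. j > e \<Longrightarrow> app (Rm c j) w = 0"
  shows "app (Rm c e) (\<Sum>i\<le>N. scale [:coeff (h i) d:] (app (T ^ i) w)) = 0"
proof -
  have "app (Rm c (e + d)) (scale (h i) (app (T ^ i) w))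
      = app (Rm c e) (scale [:coeff (h i) d:] (app (T ^ i) w))" if "i \<le> N" for i
  proof -
    have "app (Rm c j) (app (T ^ i) w) = 0" if "j > e" for j
      using e[OF that] calR_commute[OF Rm_in_calR calR_power[OF T]] by (metis app_ring(6) app_zero)
    then show ?thesis
      using Rm_scale_top d[OF that] by (simp add: calR_scale[OF Rm_in_calR])
  qed
  then have "app (Rm c e) (\<Sum>i\<le>N. scale [:coeff (h i) d:] (app (T ^ i) w))
      = app (Rm c (e + d)) (\<Sum>i\<le>N. scale (h i) (app (T ^ i) w))"
    by (simp add: app_sum)
  then show ?thesis
    by (simp add: rel)
qed

lemma lprod_zero_right_span:
  assumes "span B = UNIV" "\<And>b. b \<in> B \<Longrightarrow> lprod a b = 0"
  shows "lprod a c = 0"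
proof -
  have "c \<in> span B"
    using assms(1) by simp
  then have "\<forall>s. app (R c s) a = 0"
  proof (induction rule: span_induct_alt)
    case base
    then show ?case by (simp add: app_R)
  next
    case (step h b c)
    have "app (R b s) a = 0" for s
      using R_eq_0_iff[of b a] assms(2)[OF step(1)] by blast
    then show ?case
      using step(2) by (simp add: R_add R_scale)
  qed
  then show ?thesis
    using R_eq_0_iff by blast
qed

text \<open>
  Let \<open>Q = p(T)\<close>, where \<open>p\<close> collects the coefficients of a relation at the highest power of \<open>\<partial>\<close>.
  Each application of \<open>Q\<close> lowers the degree of \<open>R\<^sub>c(\<lambda>)v\<close> in \<open>\<lambda>\<close>, so a power of \<open>Q\<close> maps \<open>v\<close> into the left
  annihilator.
\<close>

lemma locally_algebraic:
  assumes T: "T \<in> calR" "weight 0 T"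
  shows "\<exists>p. p \<noteq> 0 \<and> app (opoly p T) v = 0"
proof -
  obtain B where B: "finite B" "span B = UNIV"
    using finite_conformal by (auto simp: finite_conformal_def)
  define N where "N = card B"
  obtain h where h: "\<exists>i\<in>{..N}. h i \<noteq> 0" "(\<Sum>i\<le>N. scale (h i) (app (T ^ i) v)) = 0"
    using family_dependent[OF B(1), of "{..N}" "\<lambda>i. app (T ^ i) v"] B(2) by (auto simp: N_def)
  \<comment> \<open>the highest power of \<open>\<partial>\<close> in the relation\<close>
  define d where "d = Max (degree ` {q \<in> h ` {..N}. q \<noteq> 0})"
  have fin: "finite (degree ` {q \<in> h ` {..N}. q \<noteq> 0})"
    by simp
  have "d \<in> degree ` {q \<in> h ` {..N}. q \<noteq> 0}"
    unfolding d_def using h(1) by (intro Max_in fin) auto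
  then obtain i0 where i0: "i0 \<le> N" "h i0 \<noteq> 0" "degree (h i0) = d"
    by auto
  have d: "degree (h i) \<le> d" if "i \<le> N" for i
  proof (cases "h i = 0")
    case False
    then show ?thesis
      unfolding d_def using that by (intro Max_ge fin) auto
  qed simp
  define p where "p = (\<Sum>i\<le>N. monom (coeff (h i) d) i)"
  have cp: "coeff p i = (if i \<le> N then coeff (h i) d else 0)" for i
    by (simp add: p_def coeff_sum)
  have "coeff p i0 \<noteq> 0"
    using i0 leading_coeff_neq_0[of "h i0"] by (simp add: cp)
  then have p0: "p \<noteq> 0"
    by auto
  have "degree p \<le> N"
    by (rule degree_le) (simp add: cp)
  then have Q: "app (opoly p T) w = (\<Sum>i\<le>N. scale [:coeff (h i) d:] (app (T ^ i) w))" for w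
    by (simp add: opoly_bound app_sum_left cp)
  define Q where "Q = opoly p T"
  have QR: "Q \<in> calR" and Q0: "weight 0 Q"
    using T by (simp_all add: Q_def opoly_calR opoly_weight_0)
  have rel: "(\<Sum>i\<le>N. scale (h i) (app (T ^ i) (app (Q ^ k) v))) = 0" for k
  proof (induction k)
    case (Suc k)
    have "app (T ^ i) (app (Q ^ Suc k) v) = app Q (app (T ^ i) (app (Q ^ k) v))" for i
      using calR_commute[OF calR_power[OF T(1)] QR, of i] by (metis app_ring(6) power_Suc)
    then have "(\<Sum>i\<le>N. scale (h i) (app (T ^ i) (app (Q ^ Suc k) v)))
        = app Q (\<Sum>i\<le>N. scale (h i) (app (T ^ i) (app (Q ^ k) v)))"
      by (simp add: app_sum weight_app[OF Q0])
    then show ?case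
      by (simp add: Suc.IH)
  qed (use h in simp)
  have "\<exists>k. \<forall>k'\<ge>k. lprod (app (Q ^ k') v) c = 0" for c
  proof -
    obtain e where e: "\<And>j. j > e \<Longrightarrow> app (Rm c j) v = 0"
      using Rm_eventually_0 by blast
    have "\<forall>j. j + k > e \<longrightarrow> app (Rm c j) (app (Q ^ k) v) = 0" for k
    proof (induction k)
      case (Suc k)
      show ?case
      proof (intro allI impI)
        fix j assume "j + Suc k > e"
        then consider "j + k > e" | "j + k = e" by linarith
        then show "app (Rm c j) (app (Q ^ Suc k) v) = 0"
        proof cases
          case 1
          then have "app (Rm c j) (app (Q ^ k) v) = 0"
            using Suc.IH by blast
          then show ?thesis
            using calR_commute[OF Rm_in_calR QR, of c j] by (metis app_ring(6) app_zero power_Suc)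
        next
          case 2
          then have "app (Rm c j') (app (Q ^ k) v) = 0" if "j' > j" for j'
            using Suc.IH that by simp
          from leading_relation[OF T(1) d rel this] show ?thesis
            by (simp add: Q_def Q)
        qed
      qed
    qed (use e in simp)
    then have "\<forall>j. app (Rm c j) (app (Q ^ k) v) = 0" if "k \<ge> Suc e" for k
      using that by simp
    then show ?thesis
      using Rm_eq_0_iff by blast
  qed
  then obtain K where K: "\<And>c k'. k' \<ge> K c \<Longrightarrow> lprod (app (Q ^ k') v) c = 0"
    by metis
  have "app (Q ^ (\<Sum>b\<in>B. K b)) v = 0"
  proof (rule left_annihilator, rule lprod_zero_right_span[OF B(2)])
    fix b assume "b \<in> B"
    then have "K b \<le> (\<Sum>b\<in>B. K b)"
      using B(1) by (intro member_le_sum) auto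
    then show "lprod (app (Q ^ (\<Sum>b\<in>B. K b)) v) b = 0"
      by (rule K)
  qed
  then show ?thesis
    using p0 by (intro exI[of _ "p ^ (\<Sum>b\<in>B. K b)"]) (simp add: opoly_power[OF T(1)] Q_def)
qed

text \<open>
  Multiply the polynomials obtained for the elements of a finite generating set.
\<close>

lemma algebraic:
  assumes T: "T \<in> calR" "weight 0 T"
  shows "\<exists>p. p \<noteq> 0 \<and> opoly p T = 0"
proof -
  obtain B where B: "finite B" "span B = UNIV"
    using finite_conformal by (auto simp: finite_conformal_def)
  obtain p where p: "\<And>v. p v \<noteq> 0" "\<And>v. app (opoly (p v) T) v = 0"
    using locally_algebraic[OF T] by metis
  define P where "P = (\<Prod>b\<in>B. p b)"
  have "app (opoly P T) b = 0" if "b \<in> B" for b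
  proof -
    have "P = (\<Prod>b\<in>B - {b}. p b) * p b"
      using B(1) that by (simp add: P_def prod.remove mult.commute)
    then show ?thesis
      using p(2) by (simp add: opoly_mult[OF T(1)])
  qed
  then have "app (opoly P T) v = 0" for v
    using weight_zero_on_span[OF opoly_weight_0[OF T], of B P v] B(2) by auto
  then have "opoly P T = 0"
    by (intro endo_eqI) simp
  moreover have "P \<noteq> 0"
    using B(1) p(1) by (simp add: P_def)
  ultimately show ?thesis by blast
qed

section \<open>Primitive idempotents\<close>

text \<open>
  A derivation kills idempotents: \<open>e' = 2ee'\<close> gives \<open>ee' = 2ee'\<close>.
\<close>

lemma bracket_idempotent:
  assumes e: "e \<in> calR" "e * e = e" and d: "bracket d e \<in> calR"
  shows "bracket d e = 0"
proof -
  define x where "x = bracket d e"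
  have c: "x * e = e * x"
    using calR_commute[OF d e(1)] by (simp add: x_def)
  have x: "x = x * e + e * x"
    using bracket_mult[of d e e] e(2) by (simp add: x_def)
  have "e * x = e * (x * e) + e * (e * x)"
    by (subst x) (simp only: distrib_left)
  also have "\<dots> = e * x + e * x"
    unfolding c by (simp add: e(2) flip: mult.assoc)
  finally have "e * x = 0"
    by simp
  then show ?thesis
    using x c by (simp add: x_def)
qed

lemma idempotent_weight_0:
  assumes "e \<in> calR" "e * e = e"
  shows "weight 0 e"
  using weight_0_iff[OF assms(1)] bracket_idempotent[OF assms bracket_del_calR[OF assms(1)]] by simp

definition orthogonal_idempotents :: "'v endo set \<Rightarrow> bool" where
  "orthogonal_idempotents F \<longleftrightarrow> finite F \<and> F \<subseteq> calR \<and> (\<forall>e\<in>F. e * e = e \<and> e \<noteq> 0) \<and>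
     (\<forall>e\<in>F. \<forall>f\<in>F. e \<noteq> f \<longrightarrow> e * f = 0)"

text \<open>
  Nonzero vectors in the images of orthogonal idempotents are independent.
\<close>

lemma orthogonal_idempotents_card:
  assumes F: "orthogonal_idempotents F" and B: "finite B" "span B = UNIV"
  shows "card F \<le> card B"
proof (rule ccontr)
  assume "\<not> card F \<le> card B"
  have "\<exists>v. app e v \<noteq> 0" if "e \<in> F" for e
    using that F endo_eqI[of e 0] by (auto simp: orthogonal_idempotents_def)
  then obtain v where v: "\<And>e. e \<in> F \<Longrightarrow> app e (v e) \<noteq> 0"
    by metis
  obtain h where h: "\<exists>e\<in>F. h e \<noteq> 0" "(\<Sum>e\<in>F. scale (h e) (app e (v e))) = 0"
    using family_dependent[OF B(1), of F "\<lambda>e. app e (v e)"] \<open>\<not> card F \<le> card B\<close> F B(2)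
    by (auto simp: orthogonal_idempotents_def)
  then obtain e where e: "e \<in> F" "h e \<noteq> 0" by blast
  have e': "e \<in> calR" "e * e = e"
    using F e by (auto simp: orthogonal_idempotents_def)
  have "0 = app e (\<Sum>f\<in>F. scale (h f) (app f (v f)))"
    using h by simp
  also have "\<dots> = (\<Sum>f\<in>F. scale (h f) (app (e * f) (v f)))"
    by (simp add: app_sum weight_app[OF idempotent_weight_0[OF e']])
  also have "\<dots> = (\<Sum>f\<in>{e}. scale (h f) (app (e * f) (v f)))"
  proof (intro sum.mono_neutral_right ballI)
    fix f assume "f \<in> F - {e}"
    then have "e * f = 0"
      using F e(1) by (auto simp: orthogonal_idempotents_def)
    then show "scale (h f) (app (e * f) (v f)) = 0"
      by (simp only: app_ring(1) scale_zero_right)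
  qed (use F e(1) in \<open>auto simp: orthogonal_idempotents_def\<close>)
  finally have "scale (h e) (app e (v e)) = 0"
    using e'(2) by (simp del: app_ring(6))
  then show False
    using torsion_free v e by blast
qed

end

locale closed_semisimple_novikov_algebra = semisimple_novikov_algebra scale lprod
  for scale :: "'k::{alg_closed_field, field_char_0} poly \<Rightarrow> 'v::ab_group_add \<Rightarrow> 'v"
    and lprod :: "'v \<Rightarrow> 'v \<Rightarrow> 'v poly"
begin

definition primitive :: "'v endo \<Rightarrow> bool" where
  "primitive e \<longleftrightarrow> e \<in> calR \<and> e * e = e \<and> e \<noteq> 0 \<and>
     (\<forall>X\<in>calR. weight 0 X \<longrightarrow> (\<exists>a. X * e = kc a * e))"

text \<open>
  If \<open>(x - a) q\<close> is a polynomial of least degree that kills \<open>X\<close> on the image of \<open>e\<close>, then \<open>Y = q(X) e\<close> is nonzero and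
  \<open>Y\<^sup>2 = q(a) Y\<close>.  As there are no nilpotents, \<open>q(a) \<noteq> 0\<close>, and \<open>Y / q(a)\<close> is idempotent.
\<close>

lemma eigenprojection:
  assumes X: "X \<in> calR" "weight 0 X" and e: "e \<in> calR" "e * e = e" "e \<noteq> 0"
  shows "\<exists>f a. f \<in> calR \<and> f * f = f \<and> f \<noteq> 0 \<and> e * f = f \<and> X * f = kc a * f"
proof -
  have "\<exists>p. p \<noteq> 0 \<and> opoly p X * e = 0"
    using algebraic[OF X] by fastforce
  then obtain p where p: "p \<noteq> 0" "opoly p X * e = 0"
    and min: "\<And>q. q \<noteq> 0 \<and> opoly q X * e = 0 \<Longrightarrow> degree p \<le> degree q"
    using ex_has_least_nat[of "\<lambda>p. p \<noteq> 0 \<and> opoly p X * e = 0" _ degree] by blast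
  have "degree p \<noteq> 0"
  proof
    assume "degree p = 0"
    then obtain a where "p = [:a:]"
      by (rule degree_eq_zeroE)
    then show False
      using p e(3) kc_cancel[of a e] by auto
  qed
  then obtain a where "poly p a = 0"
    using alg_closed_imp_poly_has_root[of p] by auto
  then obtain q where q: "p = [:- a, 1:] * q"
    by (auto simp: poly_eq_0_iff_dvd)
  define Y where "Y = opoly q X * e"
  have "Y \<noteq> 0"
  proof
    assume "Y = 0"
    moreover have "q \<noteq> 0"
      using p(1) q by auto
    moreover from this have "degree p = Suc (degree q)"
      unfolding q by (subst degree_mult_eq) auto
    ultimately show False
      using min[of q] by (simp add: Y_def)
  qed
  have YR: "Y \<in> calR" and Y0: "weight 0 Y"
    using weight_mult[OF opoly_weight_0[OF X] idempotent_weight_0[OF e(1,2)], of q]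
    by (simp_all add: Y_def calR_mult opoly_calR X e)
  have "kc (- a) * Y + X * Y = opoly p X * e"
    unfolding q opoly_mult[OF X(1)] opoly_pCons[OF X(1)] opoly_const by (simp add: Y_def distrib_right mult.assoc)
  moreover have "kc (- a) * Y = - (kc a * Y)"
    by (rule endo_eqI) (simp flip: scale_minus_left)
  ultimately have XY: "X * Y = kc a * Y"
    using p(2) by (simp add: eq_neg_iff_add_eq_0 add.commute)
  have eY: "e * Y = Y"
  proof -
    have "e * Y = opoly q X * (e * e)"
      unfolding Y_def using calR_commute[OF e(1) opoly_calR[OF X(1)], of q] by (metis mult.assoc)
    then show ?thesis
      by (simp add: e Y_def)
  qed
  have YY: "Y * Y = kc (poly q a) * Y"
    using opoly_eigen[OF X(1) XY, of q] eY by (simp add: Y_def mult.assoc)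
  have "poly q a \<noteq> 0"
  proof
    assume "poly q a = 0"
    then have "Y ^ 2 = 0"
      using YY by (simp add: power2_eq_square)
    then show False
      using calR_reduced[OF YR Y0] \<open>Y \<noteq> 0\<close> by blast
  qed
  define f where "f = kc (inverse (poly q a)) * Y"
  have k: "Y * kc b = kc b * Y" "X * kc b = kc b * X" "e * kc b = kc b * e" for b
    using calR_kc YR X e by simp_all
  have "f * f = kc (inverse (poly q a)) * (Y * kc (inverse (poly q a))) * Y"
    by (simp only: f_def mult.assoc)
  also have "\<dots> = kc (inverse (poly q a)) * (kc (inverse (poly q a)) * (kc (poly q a) * Y))"
    unfolding k by (simp only: mult.assoc YY)
  also have "\<dots> = f"
    using \<open>poly q a \<noteq> 0\<close> unfolding f_def by (simp flip: mult.assoc kc_mult)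
  finally have "f * f = f" .
  moreover have "f \<noteq> 0"
    using \<open>Y \<noteq> 0\<close> \<open>poly q a \<noteq> 0\<close> kc_cancel[of "inverse (poly q a)" Y] by (auto simp: f_def)
  moreover have "e * f = f"
    unfolding f_def by (simp only: mult.assoc[symmetric] k(3)) (simp only: mult.assoc eY)
  moreover have "X * f = kc a * f"
  proof -
    have "X * f = kc (inverse (poly q a)) * (kc a * Y)"
      unfolding f_def by (simp only: mult.assoc[symmetric] k(2)) (simp only: mult.assoc XY)
    also have "\<dots> = kc a * f"
      unfolding f_def by (simp only: mult.assoc[symmetric] kc_mult[symmetric] mult.commute[of a])
    finally show ?thesis .
  qed
  moreover have "f \<in> calR"
    by (simp add: f_def calR_mult kc_in_calR YR)
  ultimately show ?thesis by blast
qed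

text \<open>
  A family of orthogonal idempotents of largest size does the job: it could be enlarged by \<open>1 - s\<close> if its
  sum \<open>s\<close> were not 1, and by splitting a member \<open>e\<close> along an eigenprojection of \<open>X\<close> if \<open>Xe\<close> were not a
  multiple of \<open>e\<close>.
\<close>

theorem primitive_decomposition:
  "\<exists>F. orthogonal_idempotents F \<and> (\<Sum>e\<in>F. e) = 1 \<and> (\<forall>e\<in>F. primitive e)"
proof -
  obtain B where B: "finite B" "span B = UNIV"
    using finite_conformal by (auto simp: finite_conformal_def)
  have "orthogonal_idempotents {}"
    by (simp add: orthogonal_idempotents_def)
  then obtain F where F: "orthogonal_idempotents F"
    and max: "\<And>G. orthogonal_idempotents G \<Longrightarrow> card G \<le> card F"
    using ex_has_greatest_nat[of orthogonal_idempotents "{}" card "Suc (card B)"]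
      orthogonal_idempotents_card[OF _ B] by (auto simp: less_Suc_eq_le)
  have finF: "finite F" and FR: "\<And>e. e \<in> F \<Longrightarrow> e \<in> calR" and id: "\<And>e. e \<in> F \<Longrightarrow> e * e = e"
    and ne: "\<And>e. e \<in> F \<Longrightarrow> e \<noteq> 0" and orth: "\<And>e f. e \<in> F \<Longrightarrow> f \<in> F \<Longrightarrow> e \<noteq> f \<Longrightarrow> e * f = 0"
    using F by (auto simp: orthogonal_idempotents_def)
  define s where "s = (\<Sum>e\<in>F. e)"
  have sR: "s \<in> calR"
    unfolding s_def using FR finF by (induction rule: finite_induct[OF finF]) (simp_all add: calR_0 calR_add finF)
  have se: "s * e = e" if "e \<in> F" for e
  proof -
    have "s * e = (\<Sum>f\<in>F. f * e)"
      by (simp add: s_def sum_distrib_right)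
    also have "\<dots> = (\<Sum>f\<in>{e}. f * e)"
      using finF that orth by (intro sum.mono_neutral_right) auto
    finally show ?thesis
      using id that by simp
  qed
  have ss: "s * s = s"
  proof -
    have "s * s = (\<Sum>e\<in>F. s * e)"
      unfolding s_def by (simp add: sum_distrib_left)
    also have "\<dots> = s"
      unfolding s_def using se by (intro sum.cong) (auto simp: s_def)
    finally show ?thesis .
  qed
  have "s = 1"
  proof (rule ccontr)
    assume "s \<noteq> 1"
    define g where "g = 1 - s"
    have g: "g * g = g" "g \<noteq> 0" "g \<in> calR"
      using ss \<open>s \<noteq> 1\<close> by (simp_all add: g_def algebra_simps calR_diff calR_1 sR)
    have ge: "g * e = 0" "e * g = 0" if "e \<in> F" for e
      using se[OF that] calR_commute[OF g(3) FR[OF that]] by (simp_all add: g_def algebra_simps)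
    have "g \<notin> F"
      using ge(1)[of g] g by auto
    moreover have "orthogonal_idempotents (insert g F)"
      using F g ge by (auto simp: orthogonal_idempotents_def)
    ultimately show False
      using max[of "insert g F"] finF by simp
  qed
  moreover have "primitive e" if e: "e \<in> F" for e
    unfolding primitive_def
  proof (intro conjI ballI impI)
    fix X assume X: "X \<in> calR" "weight 0 X"
    obtain f a where f: "f \<in> calR" "f * f = f" "f \<noteq> 0" "e * f = f" "X * f = kc a * f"
      using eigenprojection[OF X FR[OF e] id[OF e] ne[OF e]] by blast
    have fe: "f * e = f"
      using calR_commute[OF f(1) FR[OF e]] f(4) by simp
    have "f = e"
    proof (rule ccontr)
      assume "f \<noteq> e"
      define g where "g = e - f"
      define G where "G = insert f (insert g (F - {e}))"
      have g: "g * g = g" "g \<noteq> 0" "g \<in> calR" "f * g = 0" "g * f = 0" "e * g = g" "g * e = g"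
        using \<open>f \<noteq> e\<close> f fe id[OF e] FR[OF e]
        by (simp_all add: g_def algebra_simps calR_diff)
      have o: "x * f = 0" "f * x = 0" "x * g = 0" "g * x = 0" if "x \<in> F - {e}" for x
      proof -
        have "x * e = 0" "e * x = 0"
          using orth that e by auto
        then show "x * f = 0" "f * x = 0" "x * g = 0" "g * x = 0"
          using f(4) fe g(6,7) by (metis mult.assoc mult_zero_left mult_zero_right)+
      qed
      have "f \<noteq> g"
        using g f by auto
      have "f \<notin> F - {e}" "g \<notin> F - {e}"
        using o(1)[of f] o(3)[of g] f g by auto
      moreover have "card F = Suc (card (F - {e}))"
        using finF e card.remove by fastforce
      ultimately have "card G = Suc (card F)"
        unfolding G_def using finF \<open>f \<noteq> g\<close> by simp
      moreover have "orthogonal_idempotents G"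
        using F f g o by (auto simp: G_def orthogonal_idempotents_def)
      ultimately show False
        using max[of G] by simp
    qed
    then show "\<exists>a. X * e = kc a * e"
      using f by blast
  qed (use FR id ne e in auto)
  ultimately show ?thesis
    using F by (auto simp: s_def)
qed

end

section \<open>The structure of a primitive component\<close>

lemma pderiv_surj: "\<exists>q. pderiv q = (p :: 'a::field_char_0 poly)"
proof
  let ?q = "\<Sum>i\<le>degree p. monom (coeff p i / of_nat (Suc i)) (Suc i)"
  have "pderiv (sum h A) = (\<Sum>i\<in>A. pderiv (h i))" for h :: "nat \<Rightarrow> 'a poly" and A
    by (induction A rule: infinite_finite_induct) (simp_all add: pderiv_add)
  then have "pderiv ?q = (\<Sum>i\<le>degree p. monom (coeff p i) i)"
    by (simp add: pderiv_monom del: of_nat_Suc)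
  then show "pderiv ?q = p"
    by (simp add: poly_as_sum_of_monoms)
qed

lemma bracket_diff: "bracket d (x - y) = bracket d x - bracket d y"
  by (simp add: bracket_def algebra_simps)

locale primitive_component = closed_semisimple_novikov_algebra scale lprod
  for scale :: "'k::{alg_closed_field, field_char_0} poly \<Rightarrow> 'v::ab_group_add \<Rightarrow> 'v"
    and lprod :: "'v \<Rightarrow> 'v \<Rightarrow> 'v poly" +
  fixes e :: "'v endo"
  assumes prim: "primitive e"
begin

lemma eR: "e \<in> calR" and ee: "e * e = e" and e_ne: "e \<noteq> 0"
  using prim by (simp_all add: primitive_def)

lemma weight_0_scalar: "X \<in> calR \<Longrightarrow> weight 0 X \<Longrightarrow> \<exists>a. X * e = kc a * e"
  using prim by (simp add: primitive_def)

lemma e_weight: "weight 0 e"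
  using idempotent_weight_0 eR ee .

lemma e_L: "app e (app (L a s) v) = app (L a s) (app e v)"
proof -
  have "bracket (L a s) e = 0"
    by (rule bracket_idempotent[OF eR ee bracket_L_calR[OF eR]])
  then have "app (bracket (L a s) e) v = 0"
    by simp
  then show ?thesis
    by (simp add: bracket_def)
qed

lemma e_calR: "X \<in> calR \<Longrightarrow> app e (app X v) = app X (app e v)"
  using calR_commute[OF eR] by (metis app_ring(6))

lemma kc_e_eq_0: "kc a * e = 0 \<Longrightarrow> a = 0"
  using kc_cancel e_ne by blast

lemma bracket_del_e: "bracket del e = 0" and bracket_del_kc: "bracket del (kc a) = 0"
  using weight_0_iff[OF eR] e_weight by (simp_all add: bracket_def sc_commute)

text \<open>
  On the component such an operator behaves like the derivative with respect to \<open>\<partial>\<close>: it satisfies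
  \<open>[t, \<partial>] = 1\<close> there.
\<close>

definition slice :: "'v endo \<Rightarrow> bool" where
  "slice t \<longleftrightarrow> t \<in> calR \<and> t * e = t \<and> bracket del t = - e"

lemma bracket_del_opoly:
  assumes "slice t"
  shows "bracket del (opoly p t * e) = - (opoly (pderiv p) t * e)"
proof (induction p)
  case 0
  show ?case by (simp add: bracket_def)
next
  case (pCons a p)
  have t: "t \<in> calR" "t * e = t" "bracket del t = - e"
    using assms by (simp_all add: slice_def)
  have "e * (opoly p t * e) = opoly p t * e"
    using calR_commute[OF eR opoly_calR[OF t(1)], of p] by (simp add: ee mult.assoc flip: mult.assoc[of e])
  moreover have "bracket del (opoly (pCons a p) t * e) = bracket del (kc a * e) + bracket del (t * (opoly p t * e))"
    unfolding opoly_pCons[OF t(1)] distrib_right mult.assoc by (simp add: bracket_def algebra_simps)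
  moreover have "bracket del (kc a * e) = 0"
    by (simp add: bracket_mult bracket_del_e bracket_del_kc)
  moreover have "bracket del (t * (opoly p t * e)) = - e * (opoly p t * e) + t * bracket del (opoly p t * e)"
    by (simp only: bracket_mult[of del t] t(3))
  moreover have "opoly (pderiv (pCons a p)) t * e = opoly p t * e + t * (opoly (pderiv p) t * e)"
    by (simp add: pderiv_pCons opoly_add opoly_pCons[OF t(1)] distrib_right mult.assoc)
  ultimately show ?case
    by (simp add: pCons.IH)
qed

text \<open>
  Differentiating \<open>p(t) e = 0\<close> down to a constant.
\<close>

lemma opoly_slice_inject:
  assumes t: "slice t" and "opoly p t * e = 0"
  shows "p = 0"
  using assms(2)
proof (induction "degree p" arbitrary: p)
  case 0
  then obtain a where "p = [:a:]"
    using degree_eq_zeroE by metis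
  then show ?case
    using 0 kc_e_eq_0 by simp
next
  case (Suc n)
  have "opoly (pderiv p) t * e = 0"
    using bracket_del_opoly[OF t, of p] Suc.prems by (simp add: bracket_def)
  moreover have "degree (pderiv p) = n"
    using Suc.hyps(2) by (simp add: degree_pderiv)
  ultimately have "pderiv p = 0"
    using Suc.hyps(1) by blast
  then have "degree p = 0"
    by (simp add: pderiv_eq_0_iff)
  then show ?case
    using Suc.hyps(2) by simp
qed

lemma bracket_del_Rm_e: "bracket del (Rm c 0 * e) = 0" "bracket del (Rm c (Suc j) * e) = - (Rm c j * e)"
  by (simp_all add: bracket_mult bracket_del_e bracket_del_Rm_0 bracket_del_Rm_Suc)

lemma constant_scalar:
  assumes "X \<in> calR" "X * e = X" "bracket del X = 0"
  shows "\<exists>a. X = kc a * e"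
  using weight_0_scalar[of X] weight_0_iff[of X] assms by simp

text \<open>
  The derivation \<open>[\<partial>, -]\<close> is \<open>-d/dt\<close> on polynomials in \<open>t\<close>, and its constants are scalars by
  primitivity.  So the coefficients are found by successive integration.
\<close>

lemma Rm_slice_expansion:
  assumes t: "slice t"
  shows "\<exists>p. Rm c j * e = opoly p t * e"
proof (induction j)
  case 0
  obtain a where "Rm c 0 * e = kc a * e"
    using constant_scalar[of "Rm c 0 * e"] bracket_del_Rm_e
    by (auto simp: calR_mult Rm_in_calR eR ee mult.assoc)
  then show ?case
    by (intro exI[of _ "[:a:]"]) simp
next
  case (Suc j)
  then obtain p where p: "Rm c j * e = opoly p t * e" by blast
  obtain q where q: "pderiv q = p"
    using pderiv_surj by blast
  have tR: "t \<in> calR"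
    using t by (simp add: slice_def)
  have "bracket del (Rm c (Suc j) * e - opoly q t * e) = 0"
    using bracket_del_Rm_e(2)[of c j] bracket_del_opoly[OF t, of q] p q
    by (simp add: bracket_diff)
  then obtain a where "Rm c (Suc j) * e - opoly q t * e = kc a * e"
    using constant_scalar[of "Rm c (Suc j) * e - opoly q t * e"]
    by (auto simp: calR_mult calR_diff Rm_in_calR eR ee mult.assoc opoly_calR[OF tR] left_diff_distrib)
  then have "Rm c (Suc j) * e = opoly (q + [:a:]) t * e"
    by (simp add: opoly_add distrib_right algebra_simps)
  then show ?case by blast
qed

text \<open>
  In terms of these polynomials \<open>R\<^sub>c(\<lambda>) = \<Sum>\<^sub>j \<lambda>\<^sup>j p\<^sub>j(t)\<close> on the component, with \<open>p\<^sub>j' = p\<^bsub>j-1\<^esub>\<close>.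
\<close>

definition expansion :: "'v endo \<Rightarrow> 'v \<Rightarrow> nat \<Rightarrow> 'k poly" where
  "expansion t c j = (SOME p. Rm c j * e = opoly p t * e)"

lemma expansion: "slice t \<Longrightarrow> Rm c j * e = opoly (expansion t c j) t * e"
  unfolding expansion_def by (rule someI_ex[OF Rm_slice_expansion])

lemma app_Rm_expansion: "slice t \<Longrightarrow> app e w = w \<Longrightarrow> app (Rm c j) w = app (opoly (expansion t c j) t) w"
  using expansion[of t c j] by (metis app_ring(6))

lemma pderiv_expansion:
  assumes t: "slice t"
  shows "pderiv (expansion t c 0) = 0" "pderiv (expansion t c (Suc j)) = expansion t c j"
proof -
  have "opoly (pderiv (expansion t c 0)) t * e = 0"
    using bracket_del_Rm_e(1)[of c] bracket_del_opoly[OF t] by (simp add: expansion[OF t])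
  then show "pderiv (expansion t c 0) = 0"
    by (rule opoly_slice_inject[OF t])
  have "opoly (pderiv (expansion t c (Suc j))) t * e = opoly (expansion t c j) t * e"
    using bracket_del_Rm_e(2)[of c j] bracket_del_opoly[OF t, of "expansion t c (Suc j)"]
    by (simp add: expansion[OF t])
  moreover have "opoly (p - q) t = opoly p t - opoly q t" for p q
    using opoly_add[of "p - q" q t] by simp
  ultimately have "opoly (pderiv (expansion t c (Suc j)) - expansion t c j) t * e = 0"
    by (simp add: left_diff_distrib)
  then show "pderiv (expansion t c (Suc j)) = expansion t c j"
    using opoly_slice_inject[OF t] by fastforce
qed

lemma exists_Rm_nonzero: "\<exists>c j. Rm c j * e \<noteq> 0"
proof (rule ccontr)
  assume *: "\<not> ?thesis"
  have "app e v = 0" for v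
  proof (rule left_annihilator)
    fix c
    have "app (Rm c m) (app e v) = 0" for m
      using * by (metis app_ring(1,6))
    then show "lprod (app e v) c = 0"
      using Rm_eq_0_iff by blast
  qed
  then show False
    using e_ne endo_eqI[of e 0] by simp
qed

text \<open>
  The first coefficient of \<open>R\<^sub>c(\<lambda>)\<close> that does not vanish on the component commutes with \<open>\<partial>\<close>, hence is a
  scalar; normalising it to 1, the next coefficient is a slice.
\<close>

lemma exists_slice: "\<exists>v m. Rm v m * e = e \<and> slice (Rm v (Suc m) * e)"
proof -
  define m where "m = (LEAST j. \<exists>c. Rm c j * e \<noteq> 0)"
  have ex: "\<exists>j c. Rm c j * e \<noteq> 0"
    using exists_Rm_nonzero by blast
  obtain c where c: "Rm c m * e \<noteq> 0"
    using LeastI_ex[OF ex] unfolding m_def by blast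
  have less: "Rm c j * e = 0" if "j < m" for j
    using not_less_Least[OF that[unfolded m_def]] by blast
  have "bracket del (Rm c m * e) = 0"
    using less bracket_del_Rm_e by (cases m) auto
  then obtain a where a: "Rm c m * e = kc a * e"
    using constant_scalar[of "Rm c m * e"] by (auto simp: calR_mult Rm_in_calR eR ee mult.assoc)
  then have "a \<noteq> 0"
    using c by auto
  define v where "v = scale [:inverse a:] c"
  have v: "Rm v m * e = e"
    using a \<open>a \<noteq> 0\<close> by (simp add: v_def Rm_k_scale mult.assoc) (simp flip: mult.assoc kc_mult)
  have "slice (Rm v (Suc m) * e)"
    using bracket_del_Rm_e(2)[of v m] by (simp add: slice_def calR_mult Rm_in_calR eR ee mult.assoc v)
  then show ?thesis
    using v by blast
qed

text \<open>
  Linear factors of \<open>p(t)\<close> are split off until one of them has a kernel.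
\<close>

lemma eigenvector_exists:
  assumes t: "t \<in> calR" and "p \<noteq> 0" "app (opoly p t) w = 0" "w \<noteq> 0" "app e w = w"
  shows "\<exists>u a. u \<noteq> 0 \<and> app e u = u \<and> app t u = scale [:a:] u"
  using assms(2,3)
proof (induction "degree p" arbitrary: p rule: less_induct)
  case less
  have "degree p \<noteq> 0"
  proof
    assume "degree p = 0"
    then obtain a where "p = [:a:]"
      by (rule degree_eq_zeroE)
    then show False
      using less.prems assms(4) torsion_free[of "[:a:]" w] by auto
  qed
  then obtain a where "poly p a = 0"
    using alg_closed_imp_poly_has_root[of p] by auto
  then obtain q where q: "p = [:- a, 1:] * q"
    by (auto simp: poly_eq_0_iff_dvd)
  have q0: "q \<noteq> 0"
    using less.prems(1) q by auto
  then have deg: "degree q < degree p"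
    unfolding q by (subst degree_mult_eq) auto
  show ?case
  proof (cases "app (opoly q t) w = 0")
    case True
    then show ?thesis
      using less.hyps[OF deg q0] by blast
  next
    case False
    have "scale [:- a:] v = - scale [:a:] v" for v
      by (simp flip: scale_minus_left)
    moreover have "scale [:- a:] (app (opoly q t) w) + app t (app (opoly q t) w) = app (opoly p t) w"
      unfolding q opoly_mult[OF t] opoly_pCons[OF t] opoly_const by simp
    ultimately have "app t (app (opoly q t) w) = scale [:a:] (app (opoly q t) w)"
      using less.prems(2) by (simp add: add_eq_0_iff)
    moreover have "app e (app (opoly q t) w) = app (opoly q t) w"
      using assms(5) e_calR[OF opoly_calR[OF t]] by simp
    ultimately show ?thesis
      using False by blast
  qed
qed

text \<open>
  The polynomials \<open>p\<^sub>j\<close> belonging to \<open>R\<^sub>v(\<lambda>)\<close> are nonzero for \<open>j \<ge> m\<close>, whereas \<open>R\<^sub>v(\<lambda>)w\<close> is a polynomial in \<open>\<lambda>\<close>.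
  So \<open>w\<close> is killed by some \<open>p\<^sub>j(T) \<noteq> 0\<close>, which gives an eigenvector of \<open>T\<close>; subtracting
  the eigenvalue from \<open>T\<close> leaves a slice.
\<close>

lemma exists_slice_eigenvector: "\<exists>t u. slice t \<and> u \<noteq> 0 \<and> app e u = u \<and> app t u = 0"
proof -
  obtain v m where v: "Rm v m * e = e" and T: "slice (Rm v (Suc m) * e)"
    using exists_slice by blast
  define T where "T = Rm v (Suc m) * e"
  note T = T[folded T_def]
  have TR: "T \<in> calR" and Te: "T * e = T" and dT: "bracket del T = - e"
    using T by (simp_all add: slice_def)
  obtain w' where "app e w' \<noteq> 0"
    using e_ne endo_eqI[of e 0] by auto
  then obtain w where w: "w \<noteq> 0" "app e w = w"
    using ee by (metis app_ring(6))
  obtain d where d: "\<And>j. j > d \<Longrightarrow> app (Rm v j) w = 0"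
    using Rm_eventually_0 by blast
  have ne: "expansion T v (m + i) \<noteq> 0" for i
  proof (induction i)
    case 0
    have "opoly (expansion T v m) T * e \<noteq> 0"
      using expansion[OF T, of v m] v e_ne by simp
    then show ?case by auto
  next
    case (Suc i)
    then show ?case
      using pderiv_expansion(2)[OF T, of v "m + i"] by auto
  qed
  have "app (opoly (expansion T v (m + Suc d)) T) w = 0"
    using app_Rm_expansion[OF T w(2)] d[of "m + Suc d"] by simp
  then obtain u a where u: "u \<noteq> 0" "app e u = u" "app T u = scale [:a:] u"
    using eigenvector_exists[OF TR ne _ w] by blast
  have "slice (T - kc a * e)"
    unfolding slice_def
  proof (intro conjI)
    show "T - kc a * e \<in> calR"
      by (intro calR_diff calR_mult TR kc_in_calR eR)
    show "(T - kc a * e) * e = T - kc a * e"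
      by (simp add: left_diff_distrib Te mult.assoc ee)
    show "bracket del (T - kc a * e) = - e"
      by (simp add: bracket_diff dT bracket_mult bracket_del_e bracket_del_kc)
  qed
  then show ?thesis
    using u by (intro exI[of _ "T - kc a * e"] exI[of _ u]) simp
qed

end

locale sliced_component = primitive_component scale lprod e
  for scale :: "'k::{alg_closed_field, field_char_0} poly \<Rightarrow> 'v::ab_group_add \<Rightarrow> 'v"
    and lprod :: "'v \<Rightarrow> 'v \<Rightarrow> 'v poly" and e +
  fixes t :: "'v endo" and u :: 'v
  assumes t: "slice t" and u_ne: "u \<noteq> 0" and e_u: "app e u = u" and t_u: "app t u = 0"
begin

lemma tR: "t \<in> calR"
  using t by (simp add: slice_def)

lemma k_scale_inject: "scale [:a:] u = scale [:b:] u \<longleftrightarrow> a = b"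
proof
  assume "scale [:a:] u = scale [:b:] u"
  moreover have "scale [:a - b:] u = scale [:a:] u - scale [:b:] u"
    by (simp flip: scale_left_diff_distrib)
  ultimately have "scale [:a - b:] u = 0"
    by simp
  then show "a = b"
    using torsion_free u_ne by fastforce
qed simp

definition line :: "'v set" where
  "line = range (\<lambda>a. scale [:a:] u)"

lemma k_subspace_line: "k_subspace line"
  unfolding k_subspace_def line_def
proof (intro conjI ballI allI)
  show "0 \<in> range (\<lambda>a. scale [:a:] u)"
    by (intro range_eqI[of _ _ 0]) simp
next
  fix x y assume "x \<in> range (\<lambda>a. scale [:a:] u)" "y \<in> range (\<lambda>a. scale [:a:] u)"
  then obtain a b where "x = scale [:a:] u" "y = scale [:b:] u" by blast
  then show "x + y \<in> range (\<lambda>a. scale [:a:] u)"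
    by (intro range_eqI[of _ _ "a + b"]) (simp flip: scale_left_distrib)
next
  fix c x assume "x \<in> range (\<lambda>a. scale [:a:] u)"
  then obtain a where "x = scale [:a:] u" by blast
  then show "scale [:c:] x \<in> range (\<lambda>a. scale [:a:] u)"
    by (intro range_eqI[of _ _ "c * a"]) (simp add: mult.commute)
qed

text \<open>
  \<open>on w p\<close> is \<open>p(\<lambda>) w\<close> in \<open>V[\<lambda>]\<close>.
\<close>

abbreviation on :: "'v \<Rightarrow> 'k poly \<Rightarrow> 'v poly" where
  "on w p \<equiv> map_poly (\<lambda>a. scale [:a:] w) p"

lemma coeff_on: "coeff (on w p) n = scale [:coeff p n:] w"
  by (simp add: coeff_map_poly)

lemma peval_on: "peval [:s:] (on w p) = scale [:poly p s:] w"
  by (induction p) (simp_all add: map_poly_pCons mult.commute flip: scale_left_distrib)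

lemma on_line:
  assumes "\<And>n. coeff p n \<in> line"
  shows "\<exists>q. p = on u q"
  using assms
proof (induction p)
  case 0
  show ?case by (intro exI[of _ 0]) simp
next
  case (pCons x p)
  have "coeff p n \<in> line" for n
    using pCons.prems[of "Suc n"] by simp
  then obtain q where "p = on u q"
    using pCons.IH by blast
  moreover obtain a where "x = scale [:a:] u"
    using pCons.prems[of 0] by (auto simp: line_def)
  ultimately show ?case
    by (intro exI[of _ "pCons a q"]) (simp add: map_poly_pCons)
qed

lemma Rm_u: "app (Rm c j) u = scale [:coeff (expansion t c j) 0:] u"
  using app_Rm_expansion[OF t e_u] opoly_eigenvector[OF tR, where a = 0 and u = u] t_u by (simp add: poly_0_coeff_0)

text \<open>
  The eigenvalue of \<open>R\<^sub>c(\<lambda>)\<close> on \<open>u\<close>.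
\<close>

definition f :: "'v \<Rightarrow> 'k poly" where
  "f c = (SOME p. right_poly c u = on u p)"

lemma right_poly_u: "right_poly c u = on u (f c)"
proof -
  have "\<exists>p. right_poly c u = on u p"
    by (rule on_line) (use Rm_u in \<open>auto simp: line_def simp flip: app_Rm\<close>)
  then show ?thesis
    unfolding f_def by (rule someI_ex)
qed

lemma R_u: "app (R c s) u = scale [:poly (f c) s:] u"
  by (simp add: app_R_eq right_poly_u peval_on)

lemma coeff_f: "coeff (f c) j = coeff (expansion t c j) 0"
  using Rm_u[of c j] by (simp add: app_Rm right_poly_u coeff_on k_scale_inject)

lemma coeff_expansion_1: "coeff (expansion t c (Suc j)) 1 = coeff (f c) j"
  "coeff (expansion t c 0) 1 = 0"
proof -
  have *: "coeff p 1 = coeff (pderiv p) 0" for p :: "'k poly"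
    by (simp add: coeff_pderiv)
  show "coeff (expansion t c (Suc j)) 1 = coeff (f c) j" "coeff (expansion t c 0) 1 = 0"
    unfolding * by (simp_all add: pderiv_expansion[OF t] coeff_f)
qed

lemma opoly_square_zero:
  assumes "app t (app t w) = 0"
  shows "app (opoly p t) w = scale [:coeff p 0:] w + scale [:coeff p 1:] (app t w)"
proof (cases p)
  case (pCons a q)
  obtain b r where q: "q = pCons b r"
    by (rule pCons_cases)
  have "app (t * (t * opoly r t)) w = app (opoly r t) (app t (app t w))"
    using calR_commute[OF opoly_calR[OF tR] tR] by (metis app_ring(6))
  then show ?thesis
    using assms by (simp add: pCons q opoly_pCons[OF tR] app_add calR_scale[OF tR])
qed

text \<open>
  On the span of \<open>w\<close> and \<open>u\<close> the operator \<open>t\<close> has square zero, so \<open>f\<^sub>c(s) exp(st)\<close> becomes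
  \<open>f\<^sub>c(s) (1 + st)\<close>.
\<close>

lemma R_jordan:
  assumes "app e w = w" "app t w = scale [:b:] u"
  shows "app (R c s) w = scale [:poly (f c) s:] w + scale [:s * poly (f c) s * b:] u"
proof -
  have tt: "app t (app t w) = 0"
    using assms(2) by (simp add: calR_scale[OF tR] t_u)
  have "right_poly c w = on w (f c) + on u (pCons 0 (smult b (f c)))"
  proof (rule poly_eqI)
    fix j
    have "coeff (right_poly c w) j = app (opoly (expansion t c j) t) w"
      using app_Rm_expansion[OF t assms(1)] by (simp flip: app_Rm)
    also have "\<dots> = scale [:coeff (f c) j:] w + scale [:coeff (expansion t c j) 1 * b:] u"
      unfolding opoly_square_zero[OF tt] by (simp add: coeff_f assms(2) mult.commute)
    also have "\<dots> = coeff (on w (f c) + on u (pCons 0 (smult b (f c)))) j"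
      using coeff_expansion_1 by (cases j) (simp_all add: coeff_on mult.commute)
    finally show "coeff (right_poly c w) j = coeff (on w (f c) + on u (pCons 0 (smult b (f c)))) j" .
  qed
  then show ?thesis
    by (simp add: app_R_eq peval_add peval_on mult.commute mult.left_commute)
qed

text \<open>
  The first nonzero polynomial \<open>p\<^sub>j\<close> is constant, and the next one is a primitive of it.
\<close>

lemma exists_linear_expansion: "\<exists>c j a b. expansion t c j = [:a, b:] \<and> b \<noteq> 0"
proof -
  obtain c where "\<exists>j. Rm c j * e \<noteq> 0"
    using exists_Rm_nonzero by blast
  then have ex: "\<exists>j. expansion t c j \<noteq> 0"
    using expansion[OF t, of c] by (metis mult_zero_left opoly_0)
  define j where "j = (LEAST j. expansion t c j \<noteq> 0)"
  have j: "expansion t c j \<noteq> 0"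
    unfolding j_def by (rule LeastI_ex[OF ex])
  have less: "expansion t c i = 0" if "i < j" for i
    using not_less_Least[OF that[unfolded j_def]] by blast
  have "pderiv (expansion t c j) = 0"
    using pderiv_expansion[OF t] less by (cases j) auto
  then obtain b where b: "expansion t c j = [:b:]"
    using pderiv_eq_0_iff degree_eq_zeroE by metis
  have d: "pderiv (expansion t c (Suc j)) = [:b:]"
    using pderiv_expansion(2)[OF t] b by simp
  define p where "p = expansion t c (Suc j)"
  have "degree (pderiv p) = 0"
    using d by (simp add: p_def)
  then have "degree p \<le> 1"
    by (simp add: degree_pderiv)
  then have "coeff p (Suc (Suc n)) = 0" for n
    by (intro coeff_eq_0) simp
  then have "p = [:coeff p 0, coeff p 1:]"
    by (intro poly_eqI) (auto simp: coeff_pCons split: nat.split)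
  moreover have "coeff p 1 = b"
    using arg_cong[OF d, of "\<lambda>q. coeff q 0"] by (simp add: coeff_pderiv p_def)
  ultimately show ?thesis
    using b j p_def by (intro exI[of _ c] exI[of _ "Suc j"] exI[of _ "coeff p 0"] exI[of _ b]) auto
qed

lemma e_L_u: "app e (app (L a s) u) = app (L a s) u"
  by (simp add: e_L e_u)

lemma L_k_scale: "app (L a s) (scale [:c:] v) = scale [:c:] (app (L a s) v)"
  using weight_app[OF weight_L] by simp

lemma R_L_u:
  "app (R c s') (app (L a s) u) = scale [:poly (f c) s':] (app (L a s) u)
    + scale [:poly (f a) s * poly (f c) s' - poly (f (app (L a s) c)) (s + s'):] u"
proof -
  have "app (bracket (L a s) (R c s')) u = app (R (app (L a s) c) (s + s')) u - app (R c s') (app (R a s) u)"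
    by (simp add: bracket_L_R[OF novikov])
  then have "scale [:poly (f c) s':] (app (L a s) u) - app (R c s') (app (L a s) u)
      = scale [:poly (f (app (L a s) c)) (s + s'):] u - scale [:poly (f a) s * poly (f c) s':] u"
    by (simp add: bracket_def R_u L_k_scale calR_scale[OF R_in_calR] mult.commute)
  moreover have "scale [:x - y:] u = scale [:x:] u - scale [:y:] u" for x y
    by (simp flip: scale_left_diff_distrib)
  ultimately have "scale [:poly (f c) s':] (app (L a s) u) - app (R c s') (app (L a s) u)
      = - scale [:poly (f a) s * poly (f c) s' - poly (f (app (L a s) c)) (s + s'):] u"
    by simp
  then show ?thesis
    by (simp only: diff_eq_eq) simp
qed

text \<open>
  For \<open>w = L\<^sub>a(s)u\<close> the formula for \<open>[L, R]\<close> puts \<open>R\<^sub>c(s')w - f\<^sub>c(s')w\<close> on the line of \<open>u\<close>, hence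
  also its coefficients.  One of them is a nonzero multiple of \<open>tw\<close>.
\<close>

lemma t_L_u_line: "app t (app (L a s) u) \<in> line"
proof -
  define w where "w = app (L a s) u"
  obtain c j x y where c: "expansion t c j = [:x, y:]" "y \<noteq> 0"
    using exists_linear_expansion by blast
  have "coeff (right_poly c w - on w (f c)) j \<in> line"
  proof (rule coeff_in_k_subspace[OF k_subspace_line])
    fix s'
    show "peval [:s':] (right_poly c w - on w (f c)) \<in> line"
      using R_L_u[of c s' a s] by (simp add: peval_diff peval_on line_def w_def flip: app_R_eq)
  qed
  moreover have "app (Rm c j) w = scale [:x:] w + scale [:y:] (app t w)"
    using app_Rm_expansion[OF t, of w c j] e_L_u
    by (simp add: w_def c opoly_pCons[OF tR] calR_scale[OF tR])
  ultimately have "scale [:y:] (app t w) \<in> line"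
    using coeff_f[of c j] by (simp add: coeff_on c flip: app_Rm)
  then have "scale [:inverse y:] (scale [:y:] (app t w)) \<in> line"
    using k_subspace_line unfolding k_subspace_def by blast
  then show ?thesis
    using c(2) by (simp add: w_def flip: one_pCons)
qed

text \<open>
  The factor by which \<open>t L\<^sub>a(\<lambda>)\<close> acts on \<open>u\<close>.
\<close>

definition g :: "'v \<Rightarrow> 'k poly" where
  "g a = (SOME p. map_poly (app t) (lprod a u) = on u p)"

lemma t_L_u: "app t (app (L a s) u) = scale [:poly (g a) s:] u"
proof -
  have peval_t: "peval [:s:] (map_poly (app t) p) = app t (peval [:s:] p)" for s p
    by (rule peval_map) (simp_all add: app_add calR_scale[OF tR])
  have "\<exists>p. map_poly (app t) (lprod a u) = on u p"
  proof (rule on_line, rule coeff_in_k_subspace[OF k_subspace_line])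
    show "peval [:s:] (map_poly (app t) (lprod a u)) \<in> line" for s
      using t_L_u_line by (simp add: peval_t flip: app_L_peval)
  qed
  from someI_ex[OF this] have "map_poly (app t) (lprod a u) = on u (g a)"
    by (simp add: g_def)
  from arg_cong[OF this, of "peval [:s:]"] show ?thesis
    by (simp add: peval_t peval_on flip: app_L_peval)
qed

lemma f_add: "f (a + b) = f a + f b" and g_add: "g (a + b) = g a + g b"
proof -
  have "scale [:poly (f (a + b)) s:] u = scale [:poly (f a + f b) s:] u" for s
    by (simp add: R_add flip: R_u) (simp add: R_u flip: scale_left_distrib)
  then show "f (a + b) = f a + f b"
    by (simp add: k_scale_inject poly_eq_poly_eq_iff[symmetric] fun_eq_iff)
  have "scale [:poly (g (a + b)) s:] u = scale [:poly (g a + g b) s:] u" for s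
    by (simp add: L_add app_add flip: t_L_u) (simp add: t_L_u flip: scale_left_distrib)
  then show "g (a + b) = g a + g b"
    by (simp add: k_scale_inject poly_eq_poly_eq_iff[symmetric] fun_eq_iff)
qed

lemma poly_f_scale: "poly (f (scale h a)) s = poly h (- s) * poly (f a) s"
proof -
  have "scale [:poly (f (scale h a)) s:] u = scale [:poly h (- s) * poly (f a) s:] u"
    by (simp add: R_scale flip: R_u) (simp add: R_u mult.commute)
  then show ?thesis
    by (simp add: k_scale_inject)
qed

lemma poly_g_scale: "poly (g (scale h a)) s = poly h (- s) * poly (g a) s"
proof -
  have "scale [:poly (g (scale h a)) s:] u = scale [:poly h (- s) * poly (g a) s:] u"
    by (simp add: L_scale calR_scale[OF tR] flip: t_L_u) (simp add: t_L_u mult.commute)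
  then show ?thesis
    by (simp add: k_scale_inject)
qed

text \<open>
  Comparison of \<open>R\<^sub>c(s') L\<^sub>a(s) u\<close> as computed from the bracket and from the Jordan block of \<open>t\<close>.
\<close>

lemma f_L: "poly (f (app (L a s) c)) (s + s') = poly (f c) s' * (poly (f a) s - s' * poly (g a) s)"
proof -
  have "scale [:s' * poly (f c) s' * poly (g a) s:] u
      = scale [:poly (f a) s * poly (f c) s' - poly (f (app (L a s) c)) (s + s'):] u"
    using R_jordan[OF e_L_u t_L_u, of c s' a s] R_L_u[of c s' a s] by simp
  then show ?thesis
    by (simp add: k_scale_inject algebra_simps)
qed

lemma g_R: "poly (g (app (R c s) a)) x = poly (f c) s * poly (g a) (x - s)"
proof -
  have "scale [:poly (g (app (R c s) a)) x:] u = app t (app (R c s) (app (L a (x - s)) u))"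
    by (simp add: L_of_R[OF novikov] flip: t_L_u)
  also have "\<dots> = app (R c s) (app t (app (L a (x - s)) u))"
    using calR_commute[OF tR R_in_calR] by (metis app_ring(6))
  also have "\<dots> = scale [:poly (f c) s * poly (g a) (x - s):] u"
    by (simp add: t_L_u calR_scale[OF R_in_calR] R_u mult.commute)
  finally show ?thesis
    by (simp add: k_scale_inject)
qed

text \<open>
  An additive functional on which \<open>\<partial>\<close> acts by \<open>-x\<close> takes the same value on \<open>a \<circ>\<^bsub>(s)\<^esub> b\<close> and
  \<open>a \<circ>\<^bsub>(-\<partial>-(x-s))\<^esub> b\<close>.
\<close>

lemma functional_L_R:
  assumes add: "\<And>a b. \<psi> (a + b) = \<psi> a + (\<psi> b :: 'k)" and sc: "\<And>h a. \<psi> (scale h a) = poly h (- x) * \<psi> a"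
  shows "\<psi> (app (L a s) b) = \<psi> (app (R b (x - s)) a)"
proof -
  have 0: "\<psi> 0 = 0"
    using sc[of 0 0] by simp
  have "\<psi> (peval h p) = (\<Sum>n\<le>degree p. poly h (- x) ^ n * \<psi> (coeff p n))" for h p
  proof -
    have "\<psi> (sum F A) = (\<Sum>i\<in>A. \<psi> (F i))" for F and A :: "nat set"
      by (induction A rule: infinite_finite_induct) (simp_all add: 0 add)
    then show ?thesis
      by (simp add: peval_def sc)
  qed
  then show ?thesis
    by (simp add: app_L app_R prod_at_def)
qed

lemma f_L_R: "poly (f (app (L a s) b)) x = poly (f (app (R b (x - s)) a)) x"
  by (rule functional_L_R) (simp_all add: f_add poly_f_scale)

lemma g_L_R: "poly (g (app (L a s) b)) x = poly (g (app (R b (x - s)) a)) x"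
  by (rule functional_L_R) (simp_all add: g_add poly_g_scale)

lemma g_L: "poly (g (app (L a s) b)) x = poly (f b) (x - s) * poly (g a) s"
  by (simp add: g_L_R g_R)

lemma f_R: "poly (f (app (R c s) a)) x = poly (f c) s * (poly (f a) (x - s) - s * poly (g a) (x - s))"
  using f_L_R[of a "x - s" c x] f_L[of a "x - s" c s] by simp

lemma exists_f_nonzero: "\<exists>c s. s \<noteq> 0 \<and> poly (f c) s \<noteq> 0"
proof -
  obtain c j a b where c: "expansion t c j = [:a, b:]" "b \<noteq> 0"
    using exists_linear_expansion by blast
  have "f c \<noteq> 0"
  proof (cases j)
    case 0
    then show ?thesis
      using pderiv_expansion(1)[OF t, of c] c by (simp add: pderiv_pCons)
  next
    case (Suc i)
    then show ?thesis
      using coeff_expansion_1(1)[of c i] c by auto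
  qed
  \<comment> \<open>\<open>pCons 0 (f c)\<close> is \<open>x f\<^sub>c\<close>, so that a point outside its roots is also nonzero\<close>
  then have "pCons 0 (f c) \<noteq> 0"
    by simp
  then obtain s where "poly (pCons 0 (f c)) s \<noteq> 0"
    using poly_all_0_iff_0 by blast
  then show ?thesis by auto
qed

text \<open>
  Applying \<open>f\<close> to the identity for \<open>[L\<^sub>a(s), R\<^sub>c(\<mu>)] b\<close> yields that \<open>f + x g\<close> and \<open>g\<close> are proportional.
\<close>

lemma proportional:
  "poly (g b) y * (poly (f a) s + s * poly (g a) s) = poly (g a) s * (poly (f b) y + y * poly (g b) y)"
proof -
  obtain c m where c: "m \<noteq> 0" "poly (f c) m \<noteq> 0"
    using exists_f_nonzero by blast
  \<comment> \<open>the point at which the values of all four products involve only \<open>y\<close>, \<open>s\<close> and \<open>m\<close>\<close>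
  define x where "x = y + s + m"
  let ?P = "\<lambda>v. poly (f v) x"
  have neg: "f (a - b) = f a - f b" for a b
    using f_add[of "a - b" b] by simp
  have "?P (app (L a s) (app (R c m) b)) - ?P (app (R c m) (app (L a s) b))
      = ?P (app (R (app (L a s) c) (s + m)) b) - ?P (app (R c m) (app (R a s) b))"
  proof -
    have "app (bracket (L a s) (R c m)) b = app (R (app (L a s) c) (s + m)) b - app (R c m) (app (R a s) b)"
      by (simp add: bracket_L_R[OF novikov])
    then have "?P (app (L a s) (app (R c m) b) - app (R c m) (app (L a s) b))
        = ?P (app (R (app (L a s) c) (s + m)) b - app (R c m) (app (R a s) b))"
      by (simp add: bracket_def)
    then show ?thesis
      by (simp add: neg)
  qed
  moreover have "?P (app (L a s) (app (R c m) b))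
      = poly (f (app (R c m) b)) (y + m) * (poly (f a) s - (y + m) * poly (g a) s)"
    using f_L[of a s "app (R c m) b" "y + m"] by (simp add: x_def algebra_simps)
  moreover have "poly (f (app (R c m) b)) (y + m) = poly (f c) m * (poly (f b) y - m * poly (g b) y)"
    using f_R[of c m b "y + m"] by simp
  moreover have "?P (app (R c m) (app (L a s) b))
      = poly (f c) m * (poly (f (app (L a s) b)) (s + y) - m * poly (g (app (L a s) b)) (s + y))"
    using f_R[of c m "app (L a s) b" x] by (simp add: x_def algebra_simps)
  moreover have "poly (f (app (L a s) b)) (s + y) = poly (f b) y * (poly (f a) s - y * poly (g a) s)"
    by (rule f_L)
  moreover have "poly (g (app (L a s) b)) (s + y) = poly (f b) y * poly (g a) s"
    by (simp add: g_L)
  moreover have "?P (app (R (app (L a s) c) (s + m)) b)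
      = poly (f (app (L a s) c)) (s + m) * (poly (f b) y - (s + m) * poly (g b) y)"
    using f_R[of "app (L a s) c" "s + m" b x] by (simp add: x_def)
  moreover have "poly (f (app (L a s) c)) (s + m) = poly (f c) m * (poly (f a) s - m * poly (g a) s)"
    by (rule f_L)
  moreover have "?P (app (R c m) (app (R a s) b))
      = poly (f c) m * (poly (f (app (R a s) b)) (y + s) - m * poly (g (app (R a s) b)) (y + s))"
    using f_R[of c m "app (R a s) b" x] by (simp add: x_def)
  moreover have "poly (f (app (R a s) b)) (y + s) = poly (f a) s * (poly (f b) y - s * poly (g b) y)"
    using f_R[of a s b "y + s"] by simp
  moreover have "poly (g (app (R a s) b)) (y + s) = poly (f a) s * poly (g b) y"
    using g_R[of a s b "y + s"] by simp
  ultimately have "m * poly (f c) m *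
      (poly (g b) y * (poly (f a) s + s * poly (g a) s) - poly (g a) s * (poly (f b) y + y * poly (g b) y)) = 0"
    by algebra
  then show ?thesis
    using c by simp
qed

text \<open>
  If all \<open>p\<^sub>j\<close> vanish at 0 then all are zero, as each is a primitive of its predecessor.
\<close>

lemma f_zero_kills:
  assumes "f c = 0" "app e a = a"
  shows "lprod a c = 0"
proof -
  have "expansion t c j = 0" for j
  proof (induction j)
    case 0
    have "degree (expansion t c 0) = 0"
      using pderiv_expansion(1)[OF t] pderiv_eq_0_iff by blast
    then show ?case
      using coeff_f[of c 0] assms(1) by (metis coeff_0 degree_0_id pCons_0_0)
  next
    case (Suc j)
    have "degree (expansion t c (Suc j)) = 0"
      using pderiv_expansion(2)[OF t] Suc pderiv_eq_0_iff by metis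
    then show ?case
      using coeff_f[of c "Suc j"] assms(1) by (metis coeff_0 degree_0_id pCons_0_0)
  qed
  then have "app (Rm c j) a = 0" for j
    using app_Rm_expansion[OF t assms(2)] by simp
  then show ?thesis
    using Rm_eq_0_iff by blast
qed

text \<open>
  The product formulas make the common kernel of \<open>f\<close> and \<open>g\<close> on the component an ideal, and elements
  with \<open>f = 0\<close> act by zero from the right.
\<close>

lemma fg_injective:
  assumes "app e c = c" "f c = 0" "g c = 0"
  shows "c = 0"
proof -
  let ?K = "{c. app e c = c \<and> f c = 0 \<and> g c = 0}"
  have poly0: "p = 0" if "\<And>x. poly p x = 0" for p :: "'k poly"
    using that poly_all_0_iff_0 by blast
  have "?K = {0}"
  proof (rule square_zero_ideal)
    show "ideal_of UNIV ?K"
    proof (rule ideal_of_UNIV_I)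
      have "f (scale h c) = 0" "g (scale h c) = 0" if "f c = 0" "g c = 0" for h c
        by (rule poly0, simp add: poly_f_scale poly_g_scale that)+
      moreover have "f 0 = 0" "g 0 = 0"
        using f_add[of 0 0] g_add[of 0 0] by simp_all
      ultimately show "subspace ?K"
        by (auto simp: subspace_def app_add f_add g_add weight_app[OF e_weight])
    next
      fix a c s assume a: "a \<in> ?K"
      have "f (app (R c s) a) = 0" "g (app (R c s) a) = 0"
        by (rule poly0; use a in \<open>simp add: f_R g_R\<close>)+
      then show "app (R c s) a \<in> ?K"
        using a by (simp add: e_calR[OF R_in_calR])
      have "f (app (L c s) a) = 0" "g (app (L c s) a) = 0"
        by (rule poly0; use a in \<open>simp add: f_L_R f_R g_L\<close>)+
      then show "app (L c s) a \<in> ?K"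
        using a by (simp add: e_L)
    qed
  qed (use f_zero_kills in auto)
  then show ?thesis
    using assms by blast
qed

end

section \<open>Components have rank one\<close>

context conformal_algebra
begin

lemma peval_map_poly_scale_vector:
  "peval [:s:] (map_poly (\<lambda>h. scale h w) P) = scale (poly P [:s:]) w"
  by (induction P) (simp_all add: map_poly_pCons scale_left_distrib)

text \<open>
  The value of \<open>h(-\<lambda>) g(\<partial>+\<lambda>) Q(\<partial>, \<lambda>)\<close> at \<open>\<lambda> = s\<close>.
\<close>

lemma poly_rank_one_lprod:
  "poly (rank_one_lprod Q h g) [:s:] = [:poly h (- s):] * pcompose g [:s, 1:] * poly Q [:s:]"
  for Q :: "'k poly poly"
proof -
  have "poly [:[:0, 1:], 1:] [:s:] = [:s, 1:]" "poly [:0, - 1:] [:s:] = [:- s:]"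
    by (simp_all add: one_pCons)
  then show ?thesis
    by (simp only: rank_one_lprod_def poly_mult poly_pcompose pcompose_altdef[symmetric] pcompose_pCons_0)
qed

end

context semisimple_novikov_algebra
begin

lemma cyclic_inject: "w \<noteq> 0 \<Longrightarrow> scale h w = scale g w \<longleftrightarrow> h = g"
  using torsion_free[of "h - g" w] by (auto simp: scale_left_diff_distrib)

lemma isomorphic_rank_one:
  assumes W: "W = range (\<lambda>h. scale h w)" and w: "w \<noteq> 0"
    and L: "\<And>s. app (L w s) w = scale (poly Q [:s:]) w"
  shows "isomorphic_onto (*) (rank_one_lprod Q) scale lprod W"
  unfolding isomorphic_onto_def
proof (intro exI[of _ "\<lambda>h. scale h w"] conjI allI)
  show "module_hom (*) scale (\<lambda>h. scale h w)"
    by unfold_locales (simp_all add: algebra_simps scale_left_distrib)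
  show "bij_betw (\<lambda>h. scale h w) UNIV W"
    unfolding W bij_betw_def by (auto intro!: inj_onI simp: cyclic_inject[OF w])
  fix h g
  show "lprod (scale h w) (scale g w) = map_poly (\<lambda>h. scale h w) (rank_one_lprod Q h g)"
  proof (rule poly_eq_by_values)
    fix s
    have "peval [:s:] (lprod (scale h w) (scale g w)) = app (L (scale h w) s) (scale g w)"
      by (simp add: app_L_peval)
    also have "\<dots> = scale ([:poly h (- s):] * pcompose g [:s, 1:] * poly Q [:s:]) w"
      unfolding L_scale app_ring(6) weight_app[OF weight_L] L app_sc scale_scale mult.assoc ..
    also have "\<dots> = peval [:s:] (map_poly (\<lambda>h. scale h w) (rank_one_lprod Q h g))"
      unfolding peval_map_poly_scale_vector poly_rank_one_lprod ..
    finally show "peval [:s:] (lprod (scale h w) (scale g w))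
      = peval [:s:] (map_poly (\<lambda>h. scale h w) (rank_one_lprod Q h g))" .
  qed
qed

text \<open>
  If \<open>hw \<in> I\<close>, then \<open>L\<^bsub>hw\<^esub>(s)w = h(-s) L\<^sub>w(s)w\<close> lies in \<open>I\<close>.  For \<open>h(-s) \<noteq> 0\<close> this yields \<open>w \<in> I\<close> directly if
  \<open>L\<^sub>w(s)w = w\<close>, and otherwise from the difference of the values at two points \<open>s\<close>.
\<close>

lemma simple_rank_one:
  assumes W: "W = range (\<lambda>h. scale h w)" and w: "w \<noteq> 0" and ideal: "ideal_of UNIV W"
    and L: "(\<forall>s. app (L w s) w = w) \<or> (\<exists>\<alpha>. \<forall>s. app (L w s) w = scale [:\<alpha> + s, 1:] w)"
  shows "simple W"
  unfolding simple_def
proof (intro conjI allI impI)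
  have wW: "w \<in> W"
    unfolding W by (intro range_eqI[of _ _ 1]) simp
  show "subalgebra W"
    using ideal by (simp add: ideal_of_def subalgebra_def)
  have "app (L w 0) w \<noteq> 0"
    using L
  proof
    assume "\<exists>\<alpha>. \<forall>s. app (L w s) w = scale [:\<alpha> + s, 1:] w"
    then obtain a where "app (L w 0) w = scale [:a + 0, 1:] w" by blast
    then show ?thesis
      using torsion_free[of "[:a + 0, 1:]" w] w by auto
  qed (use w in simp)
  then have "lprod w w \<noteq> 0"
    by (auto simp: app_L_peval)
  then show "\<exists>a\<in>W. \<exists>b\<in>W. lprod a b \<noteq> 0"
    using wW by blast
  fix I assume I: "ideal_of W I"
  have sub: "subspace I" and IW: "I \<subseteq> W"
    using I by (simp_all add: ideal_of_def)
  have "W \<subseteq> I" if "I \<noteq> {0}"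
  proof -
    have "\<not> I \<subseteq> {0}"
      using that subspace_0[OF sub] by (simp add: subset_singleton_iff) blast
    then obtain v where v: "v \<in> I" "v \<noteq> 0"
      by (auto simp: subset_iff)
    then obtain h where h: "v = scale h w"
      using IW v(1) unfolding W by (metis imageE subsetD)
    have "h \<noteq> 0"
      using v h by auto
    have in_I: "app (L w s) w \<in> I" if "poly h (- s) \<noteq> 0" for s
    proof -
      have "app (L v s) w \<in> I"
      proof -
        have "coeff (lprod v w) n \<in> I" for n
          using I v(1) wW unfolding ideal_of_def by blast
        then show ?thesis
          using sub by (simp add: app_L_peval peval_def subspace_sum subspace_scale)
      qed
      then have "scale [:inverse (poly h (- s)):] (app (L v s) w) \<in> I"
        using sub by (simp add: subspace_scale)
      then show ?thesis
        using that by (simp add: h L_scale flip: one_pCons)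
    qed
    define h' where "h' = pcompose h [:0, - 1:]"
    have h': "poly h' s = poly h (- s)" for s
      by (simp add: h'_def poly_pcompose)
    have "h' \<noteq> 0"
      unfolding h'_def using \<open>h \<noteq> 0\<close> by (subst pcompose_eq_0_iff) auto
    then obtain s where s: "poly h (- s) \<noteq> 0"
      using poly_all_0_iff_0[of h'] h' by auto
    \<comment> \<open>the factor \<open>x - s\<close> ensures that the second point differs from the first\<close>
    have "h' * [:- s, 1:] \<noteq> 0"
      unfolding mult_eq_0_iff using \<open>h' \<noteq> 0\<close> by simp
    then obtain r where "poly (h' * [:- s, 1:]) r \<noteq> 0"
      using poly_all_0_iff_0 by blast
    then have "poly h' r * poly [:- s, 1:] r \<noteq> 0"
      by (simp only: poly_mult not_False_eq_True)
    then have r: "poly h (- r) \<noteq> 0" "r \<noteq> s"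
      using h'[of r] by auto
    from L have "w \<in> I"
    proof
      assume "\<exists>\<alpha>. \<forall>s. app (L w s) w = scale [:\<alpha> + s, 1:] w"
      then obtain a where a: "\<And>s. app (L w s) w = scale [:a + s, 1:] w" by blast
      have "scale [:a + r, 1:] w - scale [:a + s, 1:] w \<in> I"
        using in_I[OF s] in_I[OF r(1)] sub by (simp add: a subspace_diff)
      moreover have "scale [:a + r, 1:] w - scale [:a + s, 1:] w = scale [:r - s:] w"
        by (simp flip: scale_left_diff_distrib)
      ultimately have "scale [:r - s:] w \<in> I"
        by simp
      then have "scale [:inverse (r - s):] (scale [:r - s:] w) \<in> I"
        by (rule subspace_scale[OF sub])
      then show ?thesis
        using r(2) by (simp flip: one_pCons)
    next
      assume "\<forall>s. app (L w s) w = w"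
      then have "app (L w s) w = w"
        by blast
      then show ?thesis
        using in_I[OF s] by simp
    qed
    then show ?thesis
      unfolding W using sub subspace_scale by blast
  qed
  then show "I = {0} \<or> I = W"
    using IW by blast
qed

end

context sliced_component
begin

text \<open>
  The functional \<open>\<psi>\<close> identifies the component with an ideal of \<open>k[x]\<close>.  If its generator \<open>\<psi>\<^sub>w\<close> had a root
  \<open>r\<close>, then all products would vanish at \<open>r\<close>, i.e. \<open>q(r-s) \<psi>\<^sub>w(r-s) \<psi>\<^sub>w(s) = 0\<close> for all \<open>s\<close>.  So the ideal contains
  1, and the product of the corresponding vector with itself is read off from its image.
\<close>

lemma component_generator:
  fixes \<psi> :: "'v \<Rightarrow> 'k poly" and q :: "'k poly"
  assumes add: "\<And>a b. \<psi> (a + b) = \<psi> a + \<psi> b"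
    and sc: "\<And>h a s. poly (\<psi> (scale h a)) s = poly h (- s) * poly (\<psi> a) s"
    and inj: "\<And>c. app e c = c \<Longrightarrow> \<psi> c = 0 \<Longrightarrow> c = 0"
    and prod: "\<And>a b s x. poly (\<psi> (app (L a s) b)) x = poly q (x - s) * poly (\<psi> b) (x - s) * poly (\<psi> a) s"
    and q: "q \<noteq> 0"
  shows "\<exists>w. w \<noteq> 0 \<and> {v. app e v = v} = range (\<lambda>h. scale h w) \<and>
    (\<forall>s. app (L w s) w = scale (pcompose q [:- s, - 1:]) w)"
proof -
  define neg :: "'k poly \<Rightarrow> 'k poly" where "neg h = pcompose h [:0, - 1:]" for h
  have poly_neg: "poly (neg h) s = poly h (- s)" for h s
    by (simp add: neg_def poly_pcompose)
  have ext: "p = r" if "\<And>x. poly p x = poly r x" for p r :: "'k poly"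
    using that poly_eq_poly_eq_iff by blast
  have sc': "\<psi> (scale h a) = neg h * \<psi> a" for h a
    by (rule ext) (simp add: sc poly_neg)
  have nn: "neg (neg h) = h" for h
    by (rule ext) (simp add: poly_neg)
  have diff: "\<psi> (a - b) = \<psi> a - \<psi> b" for a b
    using add[of "a - b" b] by simp
  have e_closed: "app e (scale h a) = scale h a" if "app e a = a" for h a
    using that by (simp add: weight_app[OF e_weight])
  have "\<psi> u \<noteq> 0"
    using inj e_u u_ne by blast
  then obtain w where w: "app e w = w" "\<psi> w \<noteq> 0"
    and min: "\<And>v. app e v = v \<and> \<psi> v \<noteq> 0 \<Longrightarrow> degree (\<psi> w) \<le> degree (\<psi> v)"
    using ex_has_least_nat[of "\<lambda>v. app e v = v \<and> \<psi> v \<noteq> 0" u "\<lambda>v. degree (\<psi> v)"] e_u by blast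
  have dvd: "\<psi> w dvd \<psi> v" if v: "app e v = v" for v
  proof (rule ccontr)
    assume "\<not> \<psi> w dvd \<psi> v"
    then have ne: "\<psi> v mod \<psi> w \<noteq> 0"
      by (simp add: dvd_eq_mod_eq_0)
    define z where "z = v - scale (neg (\<psi> v div \<psi> w)) w"
    have z: "\<psi> z = \<psi> v mod \<psi> w"
      by (simp add: z_def diff sc' nn minus_div_mult_eq_mod)
    have "app e z = z"
      by (simp add: z_def app_diff v e_closed w)
    moreover have "\<psi> z \<noteq> 0"
      using ne z by simp
    ultimately have "degree (\<psi> w) \<le> degree (\<psi> z)"
      by (intro min conjI)
    then show False
      using degree_mod_less[OF w(2), of "\<psi> v"] ne by (simp add: z)
  qed
  have "degree (\<psi> w) = 0"
  proof (rule ccontr)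
    assume "degree (\<psi> w) \<noteq> 0"
    then obtain r where r: "poly (\<psi> w) r = 0"
      using alg_closed_imp_poly_has_root[of "\<psi> w"] by auto
    have "poly (pcompose q [:r, - 1:] * pcompose (\<psi> w) [:r, - 1:] * \<psi> w) s = 0" for s
    proof -
      have "\<psi> w dvd \<psi> (app (L w s) w)"
        by (rule dvd) (simp add: e_L w)
      then have "poly (\<psi> (app (L w s) w)) r = 0"
        using r by (auto elim: dvdE)
      then show ?thesis
        by (simp add: prod poly_pcompose)
    qed
    then have "pcompose q [:r, - 1:] * pcompose (\<psi> w) [:r, - 1:] * \<psi> w = 0"
      using poly_all_0_iff_0 by blast
    moreover have "pcompose q [:r, - 1:] \<noteq> 0" "pcompose (\<psi> w) [:r, - 1:] \<noteq> 0"
      using q w by (subst pcompose_eq_0_iff; simp)+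
    ultimately show False
      using w by simp
  qed
  then obtain k where k: "\<psi> w = [:k:]"
    by (rule degree_eq_zeroE)
  define x where "x = scale [:inverse k:] w"
  have x: "app e x = x" "\<psi> x = 1"
    using k w by (auto simp: x_def e_closed sc' neg_def one_pCons)
  have gen: "v = scale h x" if "app e v = v" "\<psi> v = neg h" for v h
    using inj[of "v - scale h x"] that by (simp add: app_diff e_closed x diff sc')
  have "x \<noteq> 0"
    using x(2) diff[of 0 0] by auto
  moreover have "{v. app e v = v} = range (\<lambda>h. scale h x)"
  proof (rule set_eqI)
    show "v \<in> {v. app e v = v} \<longleftrightarrow> v \<in> range (\<lambda>h. scale h x)" for v
      using gen[of v "neg (\<psi> v)"] nn e_closed[OF x(1)] by auto
  qed
  moreover have "app (L x s) x = scale (pcompose q [:- s, - 1:]) x" for s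
  proof (rule gen)
    show "app e (app (L x s) x) = app (L x s) x"
      by (simp add: e_L x)
    show "\<psi> (app (L x s) x) = neg (pcompose q [:- s, - 1:])"
      by (rule ext) (simp add: prod x poly_neg poly_pcompose)
  qed
  ultimately show ?thesis by blast
qed

text \<open>
  If \<open>g = 0\<close>, the functional \<open>f\<close> is injective and multiplicative in the sense of
  \<open>component_generator\<close> with \<open>q = 1\<close>.  Otherwise \<open>f\<^sub>a = (\<alpha> - x) g\<^sub>a\<close>, and \<open>g\<close> takes over with \<open>q = \<alpha> - x\<close>.
\<close>

theorem component_cases:
  "\<exists>w. w \<noteq> 0 \<and> {v. app e v = v} = range (\<lambda>h. scale h w) \<and>
    ((\<forall>s. app (L w s) w = w) \<or> (\<exists>\<alpha>. \<forall>s. app (L w s) w = scale [:\<alpha> + s, 1:] w))"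
proof (cases "\<forall>a. g a = 0")
  case True
  have "\<exists>w. w \<noteq> 0 \<and> {v. app e v = v} = range (\<lambda>h. scale h w) \<and>
    (\<forall>s. app (L w s) w = scale (pcompose 1 [:- s, - 1:]) w)"
  proof (rule component_generator[of f])
    show "poly (f (app (L a s) b)) x = poly 1 (x - s) * poly (f b) (x - s) * poly (f a) s" for a b s x
      using f_L[of a s b "x - s"] True by simp
  qed (use True fg_injective in \<open>auto simp: f_add poly_f_scale\<close>)
  then show ?thesis
    by (auto simp: pcompose_1)
next
  case False
  then obtain b y where b: "poly (g b) y \<noteq> 0"
    using poly_all_0_iff_0 by blast
  define \<alpha> where "\<alpha> = (poly (f b) y + y * poly (g b) y) / poly (g b) y"
  have f: "poly (f a) s = poly [:\<alpha>, - 1:] s * poly (g a) s" for a s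
    using proportional[of b y a s] b by (simp add: \<alpha>_def field_simps)
  have "\<exists>w. w \<noteq> 0 \<and> {v. app e v = v} = range (\<lambda>h. scale h w) \<and>
    (\<forall>s. app (L w s) w = scale (pcompose [:\<alpha>, - 1:] [:- s, - 1:]) w)"
  proof (rule component_generator[of g])
    show "poly (g (app (L a s) b)) x = poly [:\<alpha>, - 1:] (x - s) * poly (g b) (x - s) * poly (g a) s" for a b s x
      unfolding g_L f ..
    show "c = 0" if "app e c = c" "g c = 0" for c
    proof -
      have "poly (f c) s = 0" for s
        by (simp add: f that)
      then have "f c = 0"
        using poly_all_0_iff_0 by blast
      then show ?thesis
        using fg_injective that by blast
    qed
  qed (simp_all add: g_add poly_g_scale)
  then show ?thesis
    by (auto simp: pcompose_pCons)
qed

end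

context primitive_component
begin

lemma component_ideal: "ideal_of UNIV {v. app e v = v}"
proof (rule ideal_of_UNIV_I)
  show "subspace {v. app e v = v}"
    by (auto simp: subspace_def app_add weight_app[OF e_weight])
qed (simp_all add: e_L e_calR[OF R_in_calR])

theorem component_classification:
  "simple {v. app e v = v} \<and> (isomorphic_onto (*) Cur1_lprod scale lprod {v. app e v = v} \<or>
    (\<exists>\<alpha>. isomorphic_onto (*) (V_lprod \<alpha>) scale lprod {v. app e v = v}))"
proof -
  obtain t u where tu: "slice t" "u \<noteq> 0" "app e u = u" "app t u = 0"
    using exists_slice_eigenvector by blast
  interpret sliced_component scale lprod e t u
    by unfold_locales (rule tu)+
  obtain w where w: "w \<noteq> 0" "{v. app e v = v} = range (\<lambda>h. scale h w)"
    and L: "(\<forall>s. app (L w s) w = w) \<or> (\<exists>\<alpha>. \<forall>s. app (L w s) w = scale [:\<alpha> + s, 1:] w)"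
    using component_cases by blast
  have "simple {v. app e v = v}"
    by (rule simple_rank_one[OF w(2,1) component_ideal L])
  moreover from L have "isomorphic_onto (*) Cur1_lprod scale lprod {v. app e v = v} \<or>
    (\<exists>\<alpha>. isomorphic_onto (*) (V_lprod \<alpha>) scale lprod {v. app e v = v})"
  proof
    assume "\<forall>s. app (L w s) w = w"
    then show ?thesis
      unfolding Cur1_lprod_def by (intro disjI1 isomorphic_rank_one[OF w(2,1)]) simp
  next
    assume "\<exists>\<alpha>. \<forall>s. app (L w s) w = scale [:\<alpha> + s, 1:] w"
    then obtain a where "\<And>s. app (L w s) w = scale [:a + s, 1:] w" by blast
    then show ?thesis
      unfolding V_lprod_def
      by (intro disjI2 exI[of _ a] isomorphic_rank_one[OF w(2,1)]) simp
  qed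
  ultimately show ?thesis by blast
qed

end

section \<open>The decomposition\<close>

context closed_semisimple_novikov_algebra
begin

text \<open>
  A product of elements of two different components is fixed by two orthogonal idempotents.
\<close>

lemma direct_sum_of_components:
  assumes F: "orthogonal_idempotents F" "(\<Sum>e\<in>F. e) = 1" "\<And>e. e \<in> F \<Longrightarrow> primitive e"
    and E: "bij_betw E {..<k} F"
  shows "direct_sum_of_ideals k (\<lambda>i. {v. app (E i) v = v})"
  unfolding direct_sum_of_ideals_def
proof (intro conjI allI impI ballI)
  have EF: "E i \<in> F" if "i < k" for i
    using E that by (auto simp: bij_betw_def)
  have ideal: "ideal_of UNIV {v. app (E i) v = v}" if "i < k" for i
  proof -
    interpret primitive_component scale lprod "E i"
      by unfold_locales (rule F(3)[OF EF[OF that]])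
    show ?thesis by (rule component_ideal)
  qed
  then show "ideal_of UNIV {v. app (E i) v = v}" if "i < k" for i
    using that .
  have orth: "app (E i) (app (E j) v) = 0" if "i < k" "j < k" "i \<noteq> j" for i j v
  proof -
    have "E i \<noteq> E j"
      using E that by (auto simp: bij_betw_def inj_on_def)
    then have "E i * E j = 0"
      using F(1) EF that by (auto simp: orthogonal_idempotents_def)
    then show ?thesis
      by (metis app_ring(1,6))
  qed
  show "lprod a b = 0" if "i < k" "j < k" "i \<noteq> j" "a \<in> {v. app (E i) v = v}" "b \<in> {v. app (E j) v = v}"
    for i j a b
  proof (rule poly_eqI)
    fix n
    have "app (E i) (coeff (lprod a b) n) = coeff (lprod a b) n"
      "app (E j) (coeff (lprod a b) n) = coeff (lprod a b) n"
      using ideal that unfolding ideal_of_def by blast+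
    then show "coeff (lprod a b) n = coeff 0 n"
      using orth[OF that(1-3), of "coeff (lprod a b) n"] by simp
  qed
  fix v
  have idem: "app (E i) (app (E i) x) = app (E i) x" if "i < k" for i x
    using F(1) EF[OF that] by (metis app_ring(6) orthogonal_idempotents_def)
  have sum: "(\<Sum>i<k. app (E i) v) = v"
  proof -
    have "(\<Sum>i<k. E i) = (\<Sum>e\<in>F. e)"
      by (rule sum.reindex_bij_betw[OF E])
    then show ?thesis
      using app_sum_left[of E "{..<k}" v] F(2) by simp
  qed
  show "\<exists>!w. w \<in> (\<Pi>\<^sub>E i\<in>{..<k}. {v. app (E i) v = v}) \<and> v = (\<Sum>i<k. w i)"
  proof (rule ex1I[of _ "\<lambda>i\<in>{..<k}. app (E i) v"])
    show "(\<lambda>i\<in>{..<k}. app (E i) v) \<in> (\<Pi>\<^sub>E i\<in>{..<k}. {v. app (E i) v = v}) \<and>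
        v = (\<Sum>i<k. (\<lambda>i\<in>{..<k}. app (E i) v) i)"
      using sum idem by auto
  next
    fix w assume w: "w \<in> (\<Pi>\<^sub>E i\<in>{..<k}. {v. app (E i) v = v}) \<and> v = (\<Sum>i<k. w i)"
    show "w = (\<lambda>i\<in>{..<k}. app (E i) v)"
    proof (rule ext)
      fix i
      show "w i = (\<lambda>i\<in>{..<k}. app (E i) v) i"
      proof (cases "i < k")
        case True
        have fix_w: "app (E j) (w j) = w j" if "j < k" for j
          using w that by (auto simp: PiE_def Pi_def)
        have "app (E i) v = (\<Sum>j<k. app (E i) (w j))"
          using w by (simp add: app_sum)
        also have "\<dots> = (\<Sum>j\<in>{i}. app (E i) (w j))"
        proof (rule sum.mono_neutral_right)
          show "\<forall>j\<in>{..<k} - {i}. app (E i) (w j) = 0"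
            using orth[OF True] fix_w by (metis DiffD1 DiffD2 insertI1 lessThan_iff)
        qed (use True in auto)
        finally show ?thesis
          using fix_w[OF True] True by simp
      next
        case False
        then show ?thesis
          using w by (auto simp: PiE_def extensional_def)
      qed
    qed
  qed
qed

theorem direct_sum_of_rank_one:
  "\<exists>k W. direct_sum_of_ideals k W \<and>
    (\<forall>i<k. simple (W i) \<and>
      (isomorphic_onto (*) Cur1_lprod scale lprod (W i) \<or>
       (\<exists>\<alpha>. isomorphic_onto (*) (V_lprod \<alpha>) scale lprod (W i))))"
proof -
  obtain F where F: "orthogonal_idempotents F" "(\<Sum>e\<in>F. e) = 1" "\<And>e. e \<in> F \<Longrightarrow> primitive e"
    using primitive_decomposition by blast
  then have "finite F"
    by (simp add: orthogonal_idempotents_def)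
  then obtain E where E: "bij_betw E {..<card F} F"
    using ex_bij_betw_nat_finite by (metis atLeast0LessThan)
  have "simple {v. app (E i) v = v} \<and>
      (isomorphic_onto (*) Cur1_lprod scale lprod {v. app (E i) v = v} \<or>
       (\<exists>\<alpha>. isomorphic_onto (*) (V_lprod \<alpha>) scale lprod {v. app (E i) v = v}))" if "i < card F" for i
  proof -
    have "E i \<in> F"
      using E that by (auto simp: bij_betw_def)
    then interpret primitive_component scale lprod "E i"
      by unfold_locales (rule F(3))
    show ?thesis by (rule component_classification)
  qed
  then show ?thesis
    using direct_sum_of_components[OF F E] by blast
qed

end

theorem theorem3:
  fixes scale :: "'k::{alg_closed_field, field_char_0} poly \<Rightarrow> 'v::ab_group_add \<Rightarrow> 'v"
    and lprod :: "'v \<Rightarrow> 'v \<Rightarrow> 'v poly"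
  assumes "conformal_algebra scale lprod"
    and "conformal_algebra.novikov scale lprod"
    and "conformal_algebra.finite_conformal scale"
    and "conformal_algebra.semisimple scale lprod"
  shows "\<exists>k W. conformal_algebra.direct_sum_of_ideals scale lprod k W \<and>
    (\<forall>i<k. conformal_algebra.simple scale lprod (W i) \<and>
      (isomorphic_onto (*) Cur1_lprod scale lprod (W i) \<or>
       (\<exists>\<alpha>. isomorphic_onto (*) (V_lprod \<alpha>) scale lprod (W i))))"
proof -
  interpret conformal_algebra scale lprod
    by fact
  interpret closed_semisimple_novikov_algebra scale lprod
    by unfold_locales (use assms in simp_all)
  show ?thesis
    by (rule direct_sum_of_rank_one)
qed

end
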